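(* Let $\mathcal P_{\mathbf v}$ be the integer Apollonian circle packing with root quadruple $\mathbf v=(a,b,c,d)^T$. Then the set of integer curvatures of circles occurring in $\mathcal P_{\mathbf v}$, counted with multiplicity, consists of the four elements of $\mathbf v$ together with the largest elements of each vector $M\mathbf v$, where $M$ runs over all non-identity elements of the Apollonian group $\mathcal A$.
   Context: A Descartes quadruple is $(a,b,c,d)\in\mathbb R^4$ with $2(a^2+b^2+c^2+d^2)=(a+b+c+d)^2$. A Descartes quadruple with $a+b+c+d>0$ is a root quadruple if $a\le0\le b\le c\le d$ and $a+b+c\ge d$. The Apollonian group $\mathcal A\subset GL(4,\mathbb Z)$ is the group generated by $S_1,S_2,S_3,S_4$, where $S_i$ sends a column vector $(v_1,v_2,v_3,v_4)^T$ to the vector with $v_i$ replaced by $2\sum_{j\neq i}v_j-v_i$ and other entries unchanged. A Descartes configuration is a set of four mutually tangent circles (straight lines allowed, with curvature $0$) with disjoint interiors; an enclosing circle has its exterior as "interior" and is given negative curvature. An Apollonian circle packing is a packing of circles constructed from an initial Descartes configuration by repeatedly filling the interstices between mutually tangent circles with further tangent circles; it is integral if all its circles have integer curvature. $\mathcal P_{\mathbf v}$ is the packing containing a Descartes configuration with curvatures $\mathbf v$, where $\mathbf v$ is an integer root quadruple. Applying $S_i$ corresponds geometrically to replacing the $i$-th circle of a Descartes configuration by the other circle tangent to the remaining three. *)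

theory Defs
  imports "HOL-Analysis.Analysis" "HOL-Algebra.Generated_Groups"
begin

text \<open>
  Quadruples are indexed by the numeral type \<open>4\<close>, whose elements are written
  \<open>1, 2, 3, 4\<close>, with \<open>4 = 0\<close> in that type.
\<close>

definition descartes_quadruple :: "('a::linordered_idom)^4 \<Rightarrow> bool" where
  "descartes_quadruple v \<longleftrightarrow> 2 * (\<Sum>i\<in>UNIV. (v $ i)\<^sup>2) = (\<Sum>i\<in>UNIV. v $ i)\<^sup>2"

definition root_quadruple :: "('a::linordered_idom)^4 \<Rightarrow> bool" where
  "root_quadruple v \<longleftrightarrow>
     descartes_quadruple v \<and> (\<Sum>i\<in>UNIV. v $ i) > 0 \<and>
     v $ 1 \<le> 0 \<and> 0 \<le> v $ 2 \<and> v $ 2 \<le> v $ 3 \<and> v $ 3 \<le> v $ 4 \<and>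
     v $ 1 + v $ 2 + v $ 3 \<ge> v $ 4"

definition apollonian_generator :: "4 \<Rightarrow> int^4^4" where
  "apollonian_generator i =
     (\<chi> j k. if j = i then (if k = i then - 1 else 2) else (if k = j then 1 else 0))"

lemma apollonian_generator_mult_vec:
  "apollonian_generator i *v v =
     (\<chi> j. if j = i then 2 * (\<Sum>k\<in>UNIV - {i}. v $ k) - v $ i else v $ j)"
proof -
  have "(\<Sum>k\<in>UNIV. (if k = i then - 1 else 2) * v $ k)
          = 2 * (\<Sum>k\<in>UNIV - {i}. v $ k) - v $ i"
    by (subst sum.remove[of _ i]) (auto simp: sum_distrib_left intro!: sum.cong)
  moreover have "(\<Sum>k\<in>UNIV. (if k = j then 1 else 0) * v $ k) = v $ j" for j
    by (simp add: if_distrib[where f = "\<lambda>x. x * _"] cong: if_cong)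
  ultimately show ?thesis
    by (auto simp: vec_eq_iff matrix_vector_mult_def apollonian_generator_def)
qed

definition GL4Z :: "(int^4^4) monoid" where
  "GL4Z = \<lparr>carrier = {A. invertible A}, mult = (**), one = mat 1\<rparr>"

definition apollonian_group :: "(int^4^4) set" where
  "apollonian_group = generate GL4Z (range apollonian_generator)"

text \<open>
  Oriented circles in the plane, straight lines allowed. \<open>Circle c r\<close> has centre \<open>c\<close> and radius
  \<open>\<bar>r\<bar>\<close>; a negative \<open>r\<close> means that the exterior is regarded as the interior. \<open>Line n h\<close> is the line
  with unit normal \<open>n\<close> whose interior is the open half-plane that \<open>n\<close> points into. The conditions
  in \<open>oriented_circle\<close> make the representation unique.
\<close>

datatype ocircle = Circle complex real | Line complex real

primrec oriented_circle :: "ocircle \<Rightarrow> bool" where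
  "oriented_circle (Circle c r) \<longleftrightarrow> r \<noteq> 0"
| "oriented_circle (Line n h) \<longleftrightarrow> norm n = 1"

primrec curvature :: "ocircle \<Rightarrow> real" where
  "curvature (Circle c r) = 1 / r"
| "curvature (Line n h) = 0"

primrec circle_interior :: "ocircle \<Rightarrow> complex set" where
  "circle_interior (Circle c r) = (if r > 0 then ball c r else - cball c (- r))"
| "circle_interior (Line n h) = {z. n \<bullet> z > h}"

text \<open>
  The points of a circle on the Riemann sphere, with \<open>None\<close> as the point at infinity, through
  which all lines pass. Hence two distinct parallel lines are tangent (at infinity).
\<close>

primrec circle_points :: "ocircle \<Rightarrow> complex option set" where
  "circle_points (Circle c r) = Some ` sphere c \<bar>r\<bar>"
| "circle_points (Line n h) = insert None (Some ` {z. n \<bullet> z = h})"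

definition tangent :: "ocircle \<Rightarrow> ocircle \<Rightarrow> bool" where
  "tangent C C' \<longleftrightarrow> is_singleton (circle_points C \<inter> circle_points C')"

definition descartes_configuration :: "(4 \<Rightarrow> ocircle) \<Rightarrow> bool" where
  "descartes_configuration D \<longleftrightarrow>
     (\<forall>i. oriented_circle (D i)) \<and>
     (\<forall>i j. i \<noteq> j \<longrightarrow>
        tangent (D i) (D j) \<and> circle_interior (D i) \<inter> circle_interior (D j) = {})"

text \<open>
  The circles obtained from an initial Descartes configuration by repeatedly adding circles which
  complete three mutually tangent circles already present to a Descartes configuration.
\<close>

inductive_set packing_from :: "(4 \<Rightarrow> ocircle) \<Rightarrow> ocircle set" for D\<^sub>0 where
  initial: "D\<^sub>0 i \<in> packing_from D\<^sub>0"
| fill: "descartes_configuration D \<Longrightarrow> (\<And>j. j \<noteq> i \<Longrightarrow> D j \<in> packing_from D\<^sub>0) \<Longrightarrow>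
    D i \<in> packing_from D\<^sub>0"

definition apollonian_packing :: "ocircle set \<Rightarrow> bool" where
  "apollonian_packing P \<longleftrightarrow> (\<exists>D\<^sub>0. descartes_configuration D\<^sub>0 \<and> P = packing_from D\<^sub>0)"

definition packing_with_curvatures :: "ocircle set \<Rightarrow> int^4 \<Rightarrow> bool" where
  "packing_with_curvatures P v \<longleftrightarrow> apollonian_packing P \<and>
     (\<exists>D. descartes_configuration D \<and> range D \<subseteq> P \<and> (\<forall>i. curvature (D i) = of_int (v $ i)))"

end

theory Submission imports Defs
begin

text \<open>
  An oriented circle is recorded by its curvature, co-curvature and curvature times centre, a unit
  vector for a quadratic form of signature \<open>(3,1)\<close>; two circles are externally tangent
  iff the product of their vectors is \<open>-1\<close> and their sum is future-directed. The vectors of a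
  Descartes configuration form a basis with a fixed Gram matrix, and the Apollonian group acts on
  such bases. Thus every circle of the packing is an integer combination of the four initial
  vectors, whose coefficients form a row of a matrix \<open>M\<close> of the group. If \<open>M\<close> is a nonempty reduced
  word in the generators with first letter \<open>i\<close> and last letter \<open>j\<close>, then row \<open>i\<close> has its only
  negative entry at \<open>j\<close>. Hence rows determine words, which makes the circles created by different
  words distinct. The same information shows, by cancelling letters, that mutually tangent circles
  of the packing always lie in a common configuration of the orbit, so no further circles arise
  by filling interstices. Finally the circle created last has the largest curvature, because any
  two entries of a Descartes quadruple with positive sum have nonnegative sum.
\<close>

section \<open>Lorentz coordinates of oriented circles\<close>

type_synonym lvec = "real \<times> real \<times> complex"

definition mink :: "lvec \<Rightarrow> lvec \<Rightarrow> real" where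
  "mink x y = snd (snd x) \<bullet> snd (snd y) - (fst x * fst (snd y) + fst (snd x) * fst y) / 2"

text \<open>Twice the time coordinate: on \<open>(a, b, m)\<close> the form is
  \<open>|m|^2 + ((a - b) / 2)^2 - ((a + b) / 2)^2\<close>.\<close>

definition ht :: "lvec \<Rightarrow> real" where
  "ht x = fst x + fst (snd x)"

text \<open>A line gets the limit of the vectors of the circles with centre
  \<open>(h + r) *\<^sub>R n\<close> and radius \<open>r\<close> as \<open>r\<close> tends to
  infinity.\<close>

fun coords :: "ocircle \<Rightarrow> lvec" where
  "coords (Circle c r) = (1 / r, ((norm c)\<^sup>2 - r\<^sup>2) / r, c /\<^sub>R r)"
| "coords (Line n h) = (0, 2 * h, n)"

definition circle_of :: "lvec \<Rightarrow> ocircle" where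
  "circle_of x = (if fst x = 0 then Line (snd (snd x)) (fst (snd x) / 2)
     else Circle (snd (snd x) /\<^sub>R fst x) (1 / fst x))"

lemma fst_coords: "fst (coords C) = curvature C"
  by (cases C) auto

lemma mink_coords_self: "oriented_circle C \<Longrightarrow> mink (coords C) (coords C) = 1"
  by (cases C) (auto simp: mink_def dot_square_norm power2_eq_square field_simps)

lemma circle_of_coords: "oriented_circle C \<Longrightarrow> circle_of (coords C) = C"
  by (cases C) (auto simp: circle_of_def)

text \<open>On \<open>(a, b, m)\<close> the hypothesis reads \<open>|m|^2 = 1 + a * b\<close>. For
  \<open>a = 0\<close> it makes the normal a unit vector; otherwise it recovers \<open>b\<close>
  from \<open>a\<close> and \<open>m\<close>.\<close>

lemma
  assumes "mink x x = 1"
  shows oriented_circle_of: "oriented_circle (circle_of x)"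
    and coords_circle_of: "coords (circle_of x) = x"
proof -
  obtain a b m where x: "x = (a, b, m)" by (cases x) auto
  have m: "(norm m)\<^sup>2 = 1 + a * b"
    using assms by (simp add: x mink_def dot_square_norm)
  show "oriented_circle (circle_of x)"
    using m by (auto simp: x circle_of_def power2_eq_1_iff) (use norm_ge_zero[of m] in linarith)
  show "coords (circle_of x) = x"
  proof (cases "a = 0")
    case False
    have "((norm m / a)\<^sup>2 - (1/a)\<^sup>2) * a = b"
      using m False by (simp add: power_divide field_simps power2_eq_square)
    then show ?thesis using False
      by (simp add: x circle_of_def power_divide field_simps)
  qed (simp add: x circle_of_def)
qed

text \<open>With signed radii the product is \<open>(r^2 + r'^2 - d^2) / (2 * r * r')\<close> for
  centre distance \<open>d\<close>, so one equation covers inner and outer tangency.\<close>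

lemma mink_Circle_Circle:
  assumes "r \<noteq> 0" "r' \<noteq> 0"
  shows "mink (coords (Circle c r)) (coords (Circle c' r')) = -1 \<longleftrightarrow> (dist c c')\<^sup>2 = (r + r')\<^sup>2"
proof -
  have eq: "mink (coords (Circle c r)) (coords (Circle c' r')) = (r\<^sup>2 + r'\<^sup>2 - (dist c c')\<^sup>2) / (2 * r * r')"
  proof -
    have "c \<bullet> c' = ((norm c)\<^sup>2 + (norm c')\<^sup>2 - (dist c c')\<^sup>2) / 2"
      by (simp add: dist_norm power2_norm_eq_inner inner_diff_left inner_diff_right inner_commute)
    moreover have "mink (coords (Circle c r)) (coords (Circle c' r'))
        = (2 * (c \<bullet> c') - ((norm c)\<^sup>2 - r\<^sup>2) - ((norm c')\<^sup>2 - r'\<^sup>2)) / (2 * r * r')"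
      using assms by (simp add: mink_def field_simps)
    ultimately show ?thesis by simp
  qed
  show ?thesis unfolding eq using assms by (auto simp: field_simps power2_eq_square)
qed

lemma mink_add_left: "mink (x + y) z = mink x z + mink y z"
  and mink_add_right: "mink z (x + y) = mink z x + mink z y"
  and mink_scale_left: "mink (a *\<^sub>R x) z = a * mink x z"
  and mink_scale_right: "mink z (a *\<^sub>R x) = a * mink z x"
  by (simp_all add: mink_def algebra_simps add_divide_distrib)

lemma mink_commute: "mink x y = mink y x"
  by (simp add: mink_def inner_commute)

lemma ht_add: "ht (x + y) = ht x + ht y"
  by (simp add: ht_def)

lemma mink_null: "mink x x = 0 \<Longrightarrow> fst x * fst (snd x) = (norm (snd (snd x)))\<^sup>2"
  by (simp add: mink_def dot_square_norm)

lemma mink_null_add: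
  "mink x x = 1 \<Longrightarrow> mink y y = 1 \<Longrightarrow> mink x y = -1 \<Longrightarrow> mink (x + y) (x + y) = 0"
  by (simp add: mink_add_left mink_add_right mink_commute[of y x])

lemma ht_null_pos_iff:
  assumes "mink x x = 0" "fst x \<noteq> 0"
  shows "ht x > 0 \<longleftrightarrow> fst x > 0"
proof -
  have *: "fst x * fst (snd x) \<ge> 0" using mink_null[OF assms(1)] by simp
  show ?thesis
  proof (cases "fst x > 0")
    case True
    then show ?thesis using * by (auto simp: ht_def zero_le_mult_iff)
  next
    case False
    then show ?thesis using * assms(2) by (auto simp: ht_def zero_le_mult_iff)
  qed
qed

text \<open>Two unit vectors with product \<open>-1\<close> add up to a null vector, whose time orientation
  is the sign of its curvature entry unless that entry vanishes.\<close>
lemma ht_Circle_Circle: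
  assumes "r \<noteq> 0" "r' \<noteq> 0" "(dist c c')\<^sup>2 = (r + r')\<^sup>2"
  shows "ht (coords (Circle c r)) + ht (coords (Circle c' r')) > 0 \<longleftrightarrow> 1 / r + 1 / r' > 0"
proof (cases "1 / r + 1 / r' = 0")
  \<comment> \<open>Opposite curvatures make the circles concentric, so the coordinate vectors
    cancel and both sides fail.\<close>
  case True
  then have "r' = - r" using assms by (simp add: field_simps)
  moreover from this have "c' = c" using assms by simp
  ultimately show ?thesis by (simp add: ht_def)
next
  case False
  have "mink (coords (Circle c r) + coords (Circle c' r')) (coords (Circle c r) + coords (Circle c' r')) = 0"
    using assms by (intro mink_null_add mink_coords_self) (simp_all add: mink_Circle_Circle del: coords.simps)
  from ht_null_pos_iff[OF this] False show ?thesis unfolding ht_add by simp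
qed

section \<open>Tangency of spheres with signed radii\<close>

lemma weighted_mean_diff:
  fixes c c' :: "'a::real_vector"
  assumes "r + r' \<noteq> 0"
  shows "(r' *\<^sub>R c + r *\<^sub>R c') /\<^sub>R (r + r') - c = (r / (r + r')) *\<^sub>R (c' - c)"
    and "(r' *\<^sub>R c + r *\<^sub>R c') /\<^sub>R (r + r') - c' = (r' / (r + r')) *\<^sub>R (c - c')"
proof -
  let ?p = "(r' *\<^sub>R c + r *\<^sub>R c') /\<^sub>R (r + r')"
  have "(r + r') *\<^sub>R (?p - c) = r *\<^sub>R (c' - c)" "(r + r') *\<^sub>R (?p - c') = r' *\<^sub>R (c - c')"
    using assms by (simp_all add: scaleR_diff_right scaleR_add_left)
  then have "(1 / (r + r')) *\<^sub>R (r + r') *\<^sub>R (?p - c) = (1 / (r + r')) *\<^sub>R r *\<^sub>R (c' - c)"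
     "(1 / (r + r')) *\<^sub>R (r + r') *\<^sub>R (?p - c') = (1 / (r + r')) *\<^sub>R r' *\<^sub>R (c - c')"
    by simp_all
  then show "?p - c = (r / (r + r')) *\<^sub>R (c' - c)" "?p - c' = (r' / (r + r')) *\<^sub>R (c - c')"
    using assms by (simp_all add: divide_simps)
qed

text \<open>Stewart's identity, to be applied with \<open>x = z - c\<close> and
  \<open>y = z - c'\<close> for two centres \<open>c\<close> and \<open>c'\<close>.\<close>

lemma norm_weighted_sum:
  fixes x y :: "'a::real_inner"
  shows "(norm (a *\<^sub>R x + b *\<^sub>R y))\<^sup>2
    = (a + b) * (a * (norm x)\<^sup>2 + b * (norm y)\<^sup>2) - b * a * (norm (y - x))\<^sup>2"
  by (simp add: power2_norm_eq_inner inner_add_left inner_add_right inner_diff_left inner_diff_right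
      inner_commute[of y x] algebra_simps)

text \<open>The weighted mean of the centres lies on both spheres, and Stewart's identity makes its
  distance to any common point vanish.\<close>

lemma sphere_Int_sphere:
  fixes c c' :: "'a::real_inner"
  assumes "(dist c c')\<^sup>2 = (r + r')\<^sup>2" "r + r' \<noteq> 0"
  shows "sphere c \<bar>r\<bar> \<inter> sphere c' \<bar>r'\<bar> = {(r' *\<^sub>R c + r *\<^sub>R c') /\<^sub>R (r + r')}"
proof -
  define s where "s = r + r'"
  define p where "p = (r' *\<^sub>R c + r *\<^sub>R c') /\<^sub>R s"
  have s: "s \<noteq> 0" and r': "r' = s - r" and d: "(dist c c')\<^sup>2 = s\<^sup>2"
    using assms by (auto simp: s_def)
  have pc: "p - c = (r / s) *\<^sub>R (c' - c)" "p - c' = (r' / s) *\<^sub>R (c - c')"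
    using weighted_mean_diff[of r r' c c'] s by (simp_all add: p_def s_def)
  have abs_s: "norm (c - c') = \<bar>s\<bar>"
    using d by (metis abs_norm_cancel dist_norm power2_eq_iff abs_minus_cancel)
  have "p \<in> sphere c \<bar>r\<bar>" "p \<in> sphere c' \<bar>r'\<bar>"
    using s by (simp_all add: dist_commute[of _ p] dist_norm[of p] pc abs_s norm_minus_commute[of c'])
  moreover have "z = p" if "z \<in> sphere c \<bar>r\<bar>" "z \<in> sphere c' \<bar>r'\<bar>" for z
  proof -
    have "s * (s * (norm (z - p))\<^sup>2) = s * (r' * (dist c z)\<^sup>2 + r * (dist c' z)\<^sup>2) - r * r' * (dist c c')\<^sup>2"
    proof -
      have "s *\<^sub>R (z - p) = r' *\<^sub>R (z - c) + r *\<^sub>R (z - c')"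
        using s by (simp add: p_def r' algebra_simps)
      then have "(norm (s *\<^sub>R (z - p)))\<^sup>2
          = (r' + r) * (r' * (norm (z - c))\<^sup>2 + r * (norm (z - c'))\<^sup>2) - r * r' * (norm (c - c'))\<^sup>2"
        using norm_weighted_sum[of r' "z - c" r "z - c'"] by simp
      then show ?thesis
        by (simp add: power_mult_distrib power2_eq_square[of s] dist_norm norm_minus_commute[of _ z] r')
    qed
    also have "\<dots> = s * (r' * r\<^sup>2 + r * r'\<^sup>2) - r * r' * s\<^sup>2" using that d by simp
    also have "\<dots> = 0" by (simp add: r' power2_eq_square algebra_simps)
    finally show ?thesis using s by simp
  qed
  ultimately have "sphere c \<bar>r\<bar> \<inter> sphere c' \<bar>r'\<bar> = {p}"
    by blast
  then show ?thesis unfolding p_def s_def .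
qed

text \<open>If the centres were closer, the point dividing their segment in the ratio
  \<open>r : r'\<close> would lie in both balls.\<close>

lemma ball_Int_ball_empty_imp:
  fixes c c' :: "'a::real_normed_vector"
  assumes "ball c r \<inter> ball c' r' = {}" "r > 0" "r' > 0"
  shows "r + r' \<le> dist c c'"
proof (rule ccontr)
  assume less: "\<not> r + r' \<le> dist c c'"
  define s where "s = r + r'"
  define p where "p = (r' *\<^sub>R c + r *\<^sub>R c') /\<^sub>R s"
  have s: "s > 0" and r': "r' = s - r" and d: "dist c c' < s"
    using assms less by (auto simp: s_def)
  have pc: "p - c = (r / s) *\<^sub>R (c' - c)" "p - c' = (r' / s) *\<^sub>R (c - c')"
    using weighted_mean_diff[of r r' c c'] s by (simp_all add: p_def s_def)
  have "dist c p = (r / s) * dist c c'" "dist c' p = (r' / s) * dist c c'"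
    using s assms(2,3) by (simp_all add: dist_commute[of _ p] dist_norm[of p] pc)
      (simp_all add: dist_norm norm_minus_commute)
  moreover have "dist c c' / s < 1" using s d by simp
  then have "r * (dist c c' / s) < r * 1" "r' * (dist c c' / s) < r' * 1"
    using assms(2,3) by (simp_all only: mult_strict_left_mono)
  ultimately have "dist c p < r" "dist c' p < r'" by simp_all
  then have "p \<in> ball c r \<inter> ball c' r'" by simp
  then show False using assms(1) by blast
qed

lemma tangent_commute: "tangent C C' = tangent C' C"
  by (simp add: tangent_def Int_commute)

text \<open>The distance equation also holds after reversing both orientations, and for one circle
  taken with its two orientations; the sign of the curvature sum excludes these.\<close>

lemma tangent_Circle_Circle:
  assumes "r \<noteq> 0" "r' \<noteq> 0"
  shows "tangent (Circle c r) (Circle c' r') \<and>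
      circle_interior (Circle c r) \<inter> circle_interior (Circle c' r') = {} \<longleftrightarrow>
    (dist c c')\<^sup>2 = (r + r')\<^sup>2 \<and> 1 / r + 1 / r' > 0"
proof -
  have tan: "tangent (Circle c r) (Circle c' r') \<longleftrightarrow> is_singleton (sphere c \<bar>r\<bar> \<inter> sphere c' \<bar>r'\<bar>)" for c r c' r'
    by (auto simp: tangent_def is_singleton_altdef card_image simp flip: image_Int)
  have one: "is_singleton (sphere c \<bar>r\<bar> \<inter> sphere c' \<bar>r'\<bar>)"
    if "(dist c c')\<^sup>2 = (r + r')\<^sup>2" "r + r' \<noteq> 0" for c c' :: complex and r r'
    using sphere_Int_sphere[OF that] by simp
  \<comment> \<open>A disc against the exterior of another: disjointness is inclusion of discs,
    hence \<open>dist c c' + r \<le> - r'\<close>, and a common boundary point gives the reverse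
    inequality.\<close>
  have mixed: "tangent (Circle c r) (Circle c' r') \<and> ball c r \<inter> - cball c' (- r') = {} \<longleftrightarrow>
    (dist c c')\<^sup>2 = (r + r')\<^sup>2 \<and> r + r' < 0" if r: "r > 0" "r' < 0" for c r c' r'
  proof
    assume L: "tangent (Circle c r) (Circle c' r') \<and> ball c r \<inter> - cball c' (- r') = {}"
    then have "ball c r \<subseteq> cball c' (- r')" by blast
    with r have le: "dist c c' + r \<le> - r'" by (simp add: ball_subset_cball_iff)
    from L tan obtain z where z: "sphere c \<bar>r\<bar> \<inter> sphere c' \<bar>r'\<bar> = {z}"
      by (auto simp: is_singleton_def)
    then have "dist c z = r" "dist c' z = - r'" using r by auto
    with le dist_triangle[of c' z c] have d: "dist c c' = - (r + r')" by (simp add: dist_commute)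
    have "r + r' \<noteq> 0"
    proof
      assume "r + r' = 0"
      with d r have "sphere c \<bar>r\<bar> \<inter> sphere c' \<bar>r'\<bar> = sphere c r" by auto
      moreover have "c + of_real r \<in> sphere c r" "c - of_real r \<in> sphere c r"
        using r by (auto simp: dist_norm)
      ultimately have "c + of_real r = c - of_real r" using z by (metis singletonD)
      then show False using r by (simp add: algebra_simps)
    qed
    with d show "(dist c c')\<^sup>2 = (r + r')\<^sup>2 \<and> r + r' < 0"
      using zero_le_dist[of c c'] by (auto simp: power2_eq_iff)
  next
    assume R: "(dist c c')\<^sup>2 = (r + r')\<^sup>2 \<and> r + r' < 0"
    then have "dist c c' = - (r + r')"
      using zero_le_dist[of c c'] unfolding power2_eq_iff by linarith
    then have "ball c r \<subseteq> cball c' (- r')" by (simp add: ball_subset_cball_iff)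
    with R tan one show "tangent (Circle c r) (Circle c' r') \<and> ball c r \<inter> - cball c' (- r') = {}"
      by auto
  qed
  have sgn: "1 / r + 1 / r' > 0 \<longleftrightarrow> r + r' < 0" if "r * r' < 0"
  proof -
    have "1 / r + 1 / r' = (r + r') / (r * r')" using assms by (simp add: field_simps)
    then show ?thesis using that by (auto simp: zero_less_divide_iff)
  qed
  consider "r > 0" "r' > 0" | "r > 0" "r' < 0" | "r < 0" "r' > 0" | "r < 0" "r' < 0"
    using assms by linarith
  then show ?thesis
  proof cases
    case 1
    have *: "dist c c' = r + r'" if "dist c z = r" "dist c' z = r'" "ball c r \<inter> ball c' r' = {}" for z
    proof -
      have "r + r' \<le> dist c c'" using that 1 by (intro ball_Int_ball_empty_imp) auto
      moreover have "dist c c' \<le> r + r'" using that dist_triangle2[of c c' z] by simp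
      ultimately show ?thesis by simp
    qed
    have sq: "(dist c c')\<^sup>2 = (r + r')\<^sup>2 \<longleftrightarrow> dist c c' = r + r'"
      using 1 by (simp add: power2_eq_iff_nonneg)
    have "dist c c' = r + r'"
      if "is_singleton (sphere c \<bar>r\<bar> \<inter> sphere c' \<bar>r'\<bar>)" "ball c r \<inter> ball c' r' = {}"
    proof -
      from that(1) obtain z where "sphere c \<bar>r\<bar> \<inter> sphere c' \<bar>r'\<bar> = {z}" by (rule is_singletonE)
      then have "z \<in> sphere c \<bar>r\<bar> \<inter> sphere c' \<bar>r'\<bar>" by simp
      then show ?thesis using 1 that(2) by (intro * [of z]) auto
    qed
    moreover have "ball c r \<inter> ball c' r' = {}" if "dist c c' = r + r'"
      using that by (simp add: disjoint_ballI)
    moreover have "is_singleton (sphere c \<bar>r\<bar> \<inter> sphere c' \<bar>r'\<bar>)" if "dist c c' = r + r'"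
      using one[of c c' r r'] sq that 1 by simp
    moreover have "1 / r + 1 / r' > 0" using 1 by (simp add: add_pos_pos)
    moreover have "circle_interior (Circle c r) = ball c r" "circle_interior (Circle c' r') = ball c' r'"
      using 1 by simp_all
    ultimately show ?thesis unfolding tan sq by metis
  next
    case 2
    then have "circle_interior (Circle c r) = ball c r" "circle_interior (Circle c' r') = - cball c' (- r')"
      by simp_all
    then show ?thesis using mixed[OF 2, of c c'] sgn[OF mult_pos_neg[OF 2]] by metis
  next
    case 3
    then have "circle_interior (Circle c r) = - cball c (- r)" "circle_interior (Circle c' r') = ball c' r'"
      by simp_all
    then show ?thesis
      using mixed[OF 3(2,1), of c' c] sgn[OF mult_neg_pos[OF 3]]
      unfolding dist_commute[of c' c] add.commute[of r' r] tangent_commute[of "Circle c' r'"]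
        Int_commute[of "ball c' r'"]
      by metis
  next
    case 4
    \<comment> \<open>Two exteriors of discs always meet because the plane is unbounded.\<close>
    have "- cball c (- r) \<inter> - cball c' (- r') \<noteq> {}"
    proof
      assume "- cball c (- r) \<inter> - cball c' (- r') = {}"
      then have "UNIV = cball c (- r) \<union> cball c' (- r')" by blast
      moreover have "bounded (cball c (- r) \<union> cball c' (- r'))" by simp
      ultimately show False using not_bounded_UNIV by metis
    qed
    moreover have "1 / r + 1 / r' < 0" using 4 by (simp add: add_neg_neg)
    ultimately show ?thesis using 4 by auto
  qed
qed

section \<open>Tangency involving straight lines\<close>

lemma disjoint_ball_half_space_iff:
  fixes n :: "'a::real_inner"
  assumes "norm n = 1" "r > 0"
  shows "ball c r \<inter> {z. n \<bullet> z > h} = {} \<longleftrightarrow> n \<bullet> c + r \<le> h"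
proof
  assume disj: "ball c r \<inter> {z. n \<bullet> z > h} = {}"
  show "n \<bullet> c + r \<le> h"
  proof (rule field_le_epsilon)
    fix e :: real assume "e > 0"
    \<comment> \<open>The supremum \<open>n \<bullet> c + r\<close> is not attained on the open
      ball, so it is approached from within; the maximum with \<open>0\<close> keeps the point in
      the ball when \<open>e\<close> exceeds \<open>r\<close>.\<close>
    define t where "t = max 0 (r - e)"
    have t: "0 \<le> t" "t < r" "r \<le> t + e" using \<open>e > 0\<close> assms by (auto simp: t_def)
    have "c + t *\<^sub>R n \<in> ball c r" using t assms by (simp add: dist_norm)
    with disj have "n \<bullet> (c + t *\<^sub>R n) \<le> h" by auto
    then show "n \<bullet> c + r \<le> h + e" using t assms
      by (simp add: inner_add_right dot_square_norm)
  qed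
next
  assume le: "n \<bullet> c + r \<le> h"
  have "n \<bullet> z \<le> h" if "dist c z < r" for z
  proof -
    have "n \<bullet> (z - c) \<le> norm n * norm (z - c)" by (rule norm_cauchy_schwarz)
    then show ?thesis using assms le that by (simp add: inner_diff_right dist_norm norm_minus_commute)
  qed
  then show "ball c r \<inter> {z. n \<bullet> z > h} = {}" by (force simp: not_less)
qed

lemma half_space_Int_compl_cball:
  fixes n :: "'a::real_inner"
  assumes "norm n = 1"
  shows "- cball c r \<inter> {z. n \<bullet> z > h} \<noteq> {}"
proof -
  define t where "t = \<bar>r\<bar> + \<bar>h - n \<bullet> c\<bar> + 1"
  have "c + t *\<^sub>R n \<in> - cball c r \<inter> {z. n \<bullet> z > h}"
    using assms by (auto simp: t_def dist_norm inner_add_right dot_square_norm)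
  then show ?thesis by blast
qed

lemma sphere_Int_tangent_line:
  fixes n :: "'a::real_inner"
  assumes "norm n = 1" "n \<bullet> c + r = h"
  shows "sphere c \<bar>r\<bar> \<inter> {z. n \<bullet> z = h} = {c + r *\<^sub>R n}"
proof -
  have "z = c + r *\<^sub>R n" if "dist c z = \<bar>r\<bar>" "n \<bullet> z = h" for z
  proof -
    have "(norm (z - c - r *\<^sub>R n))\<^sup>2 = (dist c z)\<^sup>2 - 2 * r * (n \<bullet> z - n \<bullet> c) + r\<^sup>2 * (norm n)\<^sup>2"
      unfolding dist_norm norm_minus_commute[of c z]
      by (simp only: power2_norm_eq_inner inner_diff_left[of "z - c"]
          inner_diff_right[of _ "z - c"] inner_scaleR_left inner_scaleR_right
          inner_commute[of "z - c" n] inner_diff_right[of n]) (simp add: algebra_simps power2_eq_square)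
    also have "\<dots> = r\<^sup>2 - 2 * r * r + r\<^sup>2"
      using that by (simp add: assms(1) flip: assms(2))
    finally show ?thesis by (simp add: algebra_simps power2_eq_square)
  qed
  then show ?thesis using assms by (auto simp: dist_norm inner_add_right dot_square_norm)
qed

lemma tangent_Circle_Line:
  assumes "r \<noteq> 0" "norm n = 1"
  shows "tangent (Circle c r) (Line n h) \<and>
      circle_interior (Circle c r) \<inter> circle_interior (Line n h) = {} \<longleftrightarrow>
    mink (coords (Circle c r)) (coords (Line n h)) = -1 \<and>
    ht (coords (Circle c r)) + ht (coords (Line n h)) > 0"
proof -
  have tan: "tangent (Circle c r) (Line n h) \<longleftrightarrow> is_singleton (sphere c \<bar>r\<bar> \<inter> {z. n \<bullet> z = h})"
  proof -
    have "circle_points (Circle c r) \<inter> circle_points (Line n h) = Some ` (sphere c \<bar>r\<bar> \<inter> {z. n \<bullet> z = h})"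
      by auto
    then show ?thesis by (simp add: tangent_def is_singleton_altdef card_image)
  qed
  have mink: "mink (coords (Circle c r)) (coords (Line n h)) = -1 \<longleftrightarrow> n \<bullet> c + r = h"
    using assms by (auto simp: mink_def field_simps inner_commute)
  have ht: "ht (coords (Circle c r)) + ht (coords (Line n h)) > 0 \<longleftrightarrow> r > 0" if "n \<bullet> c + r = h"
  proof -
    \<comment> \<open>Cauchy-Schwarz bounds the numerator of the height sum below by
      \<open>1 + h\<^sup>2\<close>, so its sign is that of \<open>r\<close>.\<close>
    have "(h - r)\<^sup>2 \<le> (norm c)\<^sup>2"
      using Cauchy_Schwarz_ineq2[of n c] assms that abs_le_square_iff[of "h - r" "norm c"] by auto
    then have "1 + (norm c)\<^sup>2 - r\<^sup>2 + 2 * h * r \<ge> 1 + h\<^sup>2"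
      by (simp add: power2_eq_square algebra_simps)
    moreover have "1 + h\<^sup>2 > 0" by (simp add: add_pos_nonneg)
    moreover have "ht (coords (Circle c r)) + ht (coords (Line n h))
        = (1 + (norm c)\<^sup>2 - r\<^sup>2 + 2 * h * r) / r"
      using assms by (simp add: ht_def field_simps)
    ultimately show ?thesis by (simp add: zero_less_divide_iff)
  qed
  show ?thesis
  proof (cases "r > 0")
    case True
    \<comment> \<open>A common point of circle and line gives the reverse of the disjointness
      inequality.\<close>
    have *: "n \<bullet> c + r = h"
      if le: "n \<bullet> c + r \<le> h" and z: "dist c z = r" "n \<bullet> z = h" for z
    proof -
      have "n \<bullet> (z - c) \<le> norm n * norm (z - c)" by (rule norm_cauchy_schwarz)
      then show ?thesis using assms le z by (simp add: inner_diff_right dist_norm norm_minus_commute)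
    qed
    have "n \<bullet> c + r = h" if "is_singleton (sphere c \<bar>r\<bar> \<inter> {z. n \<bullet> z = h})" "n \<bullet> c + r \<le> h"
    proof -
      from that(1) obtain z where "sphere c \<bar>r\<bar> \<inter> {z. n \<bullet> z = h} = {z}" by (rule is_singletonE)
      then have "z \<in> sphere c \<bar>r\<bar> \<inter> {z. n \<bullet> z = h}" by simp
      then show ?thesis using True that(2) by (intro * [of z]) auto
    qed
    moreover have "is_singleton (sphere c \<bar>r\<bar> \<inter> {z. n \<bullet> z = h})" if "n \<bullet> c + r = h"
      by (simp only: sphere_Int_tangent_line[OF assms(2) that] is_singletonI)
    moreover have "circle_interior (Circle c r) \<inter> circle_interior (Line n h) = {} \<longleftrightarrow> n \<bullet> c + r \<le> h"
      using True disjoint_ball_half_space_iff[OF assms(2) True, of c h] by simp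
    ultimately show ?thesis unfolding tan mink using ht True by (metis order_refl)
  next
    case False
    then show ?thesis
      using assms mink ht half_space_Int_compl_cball[OF assms(2), of c "- r" h]
      by (auto simp del: coords.simps)
  qed
qed

lemma tangent_Line_Line:
  assumes "norm n = 1" "norm n' = 1"
  shows "tangent (Line n h) (Line n' h') \<and>
      circle_interior (Line n h) \<inter> circle_interior (Line n' h') = {} \<longleftrightarrow>
    n' = - n \<and> h + h' > 0"
proof
  assume L: "tangent (Line n h) (Line n' h') \<and>
      circle_interior (Line n h) \<inter> circle_interior (Line n' h') = {}"
  have n: "n' = - n"
  proof (rule ccontr)
    assume ne: "n' \<noteq> - n"
    \<comment> \<open>Unless the normals are opposite, both half-planes contain all points far
      enough in the direction \<open>n + n'\<close>.\<close>
    define s where "s = n + n'"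
    have "n \<bullet> n' > -1"
    proof -
      have "s \<bullet> s > 0" using ne by (simp add: s_def eq_neg_iff_add_eq_0 add.commute)
      moreover have "s \<bullet> s = 2 + 2 * (n \<bullet> n')"
        using assms unfolding s_def inner_add_left inner_add_right
        by (simp add: dot_square_norm inner_commute[of n' n])
      ultimately show ?thesis by simp
    qed
    then have pos: "n \<bullet> s > 0" "n' \<bullet> s > 0"
      using assms by (simp_all add: s_def inner_add_right dot_square_norm inner_commute)
    define t where "t = max (\<bar>h\<bar> / (n \<bullet> s)) (\<bar>h'\<bar> / (n' \<bullet> s)) + 1"
    have "t > \<bar>h\<bar> / (n \<bullet> s)" "t > \<bar>h'\<bar> / (n' \<bullet> s)" by (auto simp: t_def)
    then have "t * (n \<bullet> s) > \<bar>h\<bar>" "t * (n' \<bullet> s) > \<bar>h'\<bar>" using pos by (simp_all add: field_simps)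
    then have "t *\<^sub>R s \<in> circle_interior (Line n h) \<inter> circle_interior (Line n' h')"
      by (simp, linarith)
    then show False using L by blast
  qed
  have "h + h' \<ge> 0"
  proof (rule ccontr)
    assume "\<not> h + h' \<ge> 0"
    \<comment> \<open>Half-planes with opposite normals would overlap in a strip; this point lies on
      its middle line.\<close>
    then have "((h - h') / 2) *\<^sub>R n \<in> circle_interior (Line n h) \<inter> circle_interior (Line n' h')"
      using assms by (simp add: n dot_square_norm field_simps)
    then show False using L by blast
  qed
  moreover have "h + h' \<noteq> 0"
  proof
    assume "h + h' = 0"
    then have h': "h' = - h" by simp
    from L obtain p where "circle_points (Line n h) \<inter> circle_points (Line n' h') = {p}"
      by (auto simp: tangent_def is_singleton_def)
    moreover have "Some (h *\<^sub>R n) \<in> circle_points (Line n h) \<inter> circle_points (Line n' h')"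
      "None \<in> circle_points (Line n h) \<inter> circle_points (Line n' h')"
      using assms by (simp_all add: n h' dot_square_norm)
    ultimately show False by auto
  qed
  ultimately show "n' = - n \<and> h + h' > 0" using n by simp
next
  assume R: "n' = - n \<and> h + h' > 0"
  then have "circle_points (Line n h) \<inter> circle_points (Line n' h') = {None}" by auto
  then have "tangent (Line n h) (Line n' h')" by (simp only: tangent_def is_singletonI)
  then show "tangent (Line n h) (Line n' h') \<and>
      circle_interior (Line n h) \<inter> circle_interior (Line n' h') = {}"
    using R by auto
qed

text \<open>Turns the geometry into linear algebra. The height condition excludes reversed
  orientations and coincident circles, for which the product can also be \<open>-1\<close>.\<close>

lemma externally_tangent_iff:
  assumes "oriented_circle C" "oriented_circle C'"
  shows "tangent C C' \<and> circle_interior C \<inter> circle_interior C' = {} \<longleftrightarrow>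
    mink (coords C) (coords C') = -1 \<and> ht (coords C) + ht (coords C') > 0"
proof (cases C; cases C')
  fix c r c' r' assume C: "C = Circle c r" "C' = Circle c' r'"
  with assms have "r \<noteq> 0" "r' \<noteq> 0" by auto
  then show ?thesis unfolding C
    using tangent_Circle_Circle mink_Circle_Circle ht_Circle_Circle by metis
next
  fix c r n h assume C: "C = Circle c r" "C' = Line n h"
  with assms show ?thesis using tangent_Circle_Line by simp
next
  fix c r n h assume C: "C = Line n h" "C' = Circle c r"
  have "r \<noteq> 0" "norm n = 1" using assms C by auto
  from tangent_Circle_Line[OF this, of c h] show ?thesis unfolding C
    by (simp only: tangent_commute[of "Line n h"] mink_commute[of "coords (Line n h)"]
        Int_commute[of "circle_interior (Line n h)"] add.commute[of "ht (coords (Line n h))"])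
next
  fix n h n' h' assume C: "C = Line n h" "C' = Line n' h'"
  with assms have n: "norm n = 1" "norm n' = 1" by auto
  have "n \<bullet> n' = -1 \<longleftrightarrow> n' = - n"
  proof -
    have "(n + n') \<bullet> (n + n') = 2 * (n \<bullet> n' + 1)"
      using n unfolding inner_add_left inner_add_right
      by (simp add: dot_square_norm inner_commute[of n' n])
    then have "n \<bullet> n' = -1 \<longleftrightarrow> n + n' = 0" by auto
    then show ?thesis by (simp add: eq_neg_iff_add_eq_0 add.commute)
  qed
  then show ?thesis unfolding C tangent_Line_Line[OF n] by (auto simp: mink_def ht_def)
qed

section \<open>Reduced words in the Apollonian group\<close>

fun apo_word :: "4 list \<Rightarrow> int^4^4" where
  "apo_word [] = mat 1"
| "apo_word (i # is) = apollonian_generator i ** apo_word is"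

lemma apo_word_append: "apo_word (is @ js) = apo_word is ** apo_word js"
  by (induction "is") (simp_all add: matrix_mul_assoc)

lemma generator_mult_nth:
  "(apollonian_generator i ** M) $ j = (if j = i then 2 *s (\<Sum>k\<in>UNIV - {i}. M $ k) - M $ i else M $ j)"
proof -
  have "(\<Sum>k\<in>UNIV. (if k = i then - 1 else 2) * M $ k $ l)
          = 2 * (\<Sum>k\<in>UNIV - {i}. M $ k $ l) - M $ i $ l" for l
    by (subst sum.remove[of _ i]) (auto simp: sum_distrib_left intro!: sum.cong)
  moreover have "(\<Sum>k\<in>UNIV. (if k = j then 1 else 0) * M $ k $ l) = M $ j $ l" for l
    by (simp add: if_distrib[where f = "\<lambda>x. x * _"] cong: if_cong)
  ultimately show ?thesis
    by (auto simp: vec_eq_iff matrix_matrix_mult_def apollonian_generator_def)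
qed

section \<open>Right multiplication acting on single rows\<close>

definition row_step :: "4 \<Rightarrow> int^4 \<Rightarrow> int^4" where
  "row_step j r = (\<chi> k. if k = j then - r $ j else r $ k + 2 * r $ j)"

lemma mult_generator_nth: "(M ** apollonian_generator j) $ i = row_step j (M $ i)"
proof -
  have "(\<Sum>l\<in>UNIV. M $ i $ l * (if l = j then if k = j then - 1 else 2 else if k = l then 1 else 0))
      = (if k = j then - M $ i $ j else M $ i $ k + 2 * M $ i $ j)" for k
    by (subst sum.remove[of _ j]) (auto simp: if_distrib[where f = "\<lambda>x. _ * x"] cong: if_cong)
  then show ?thesis
    by (simp add: vec_eq_iff matrix_matrix_mult_def apollonian_generator_def row_step_def)
qed

lemma row_step_row_step [simp]: "row_step j (row_step j r) = r"
  by (simp add: row_step_def vec_eq_iff)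

lemma generator_generator: "apollonian_generator i ** apollonian_generator i = mat 1"
proof -
  \<comment> \<open>Two right multiplications applied to \<open>mat 1\<close> let the involution
    \<open>row_step\<close> act on each row.\<close>
  have "apollonian_generator i = mat 1 ** apollonian_generator i" by simp
  then have "apollonian_generator i ** apollonian_generator i = mat 1 ** apollonian_generator i ** apollonian_generator i"
    by simp
  also have "\<dots> = mat 1" by (simp add: vec_eq_iff[of _ "mat 1 :: int^4^4"] mult_generator_nth del: matrix_mul_lid)
  finally show ?thesis .
qed

lemma group_GL4Z: "group GL4Z"
proof (rule groupI)
  fix A assume "A \<in> carrier GL4Z"
  then obtain B where "A ** B = mat 1" "B ** A = mat 1"
    by (auto simp: GL4Z_def invertible_def)
  then show "\<exists>B\<in>carrier GL4Z. B \<otimes>\<^bsub>GL4Z\<^esub> A = \<one>\<^bsub>GL4Z\<^esub>"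
    by (auto simp: GL4Z_def invertible_def)
qed (auto simp: GL4Z_def invertible_mult matrix_mul_assoc invertible_def[of "mat 1"])

text \<open>Each generator is its own inverse, so words without inverse letters suffice.\<close>

lemma apollonian_group_eq_range: "apollonian_group = range apo_word"
proof
  have inv: "inv\<^bsub>GL4Z\<^esub> apollonian_generator i = apollonian_generator i" for i
    by (intro group.inv_equality[OF group_GL4Z])
      (auto simp: GL4Z_def generator_generator invertible_def intro!: exI[of _ "apollonian_generator i"])
  have gen: "apollonian_generator i \<in> range apo_word" for i
    by (rule range_eqI[of _ _ "[i]"]) simp
  show "apollonian_group \<subseteq> range apo_word"
  proof
    fix M assume "M \<in> apollonian_group"
    then show "M \<in> range apo_word" unfolding apollonian_group_def
    proof (induction rule: generate.induct)
      case one
      show ?case by (rule range_eqI[of _ _ "[]"]) (simp add: GL4Z_def)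
    next
      case (eng M N)
      then show ?case by (auto simp: GL4Z_def simp flip: apo_word_append)
    qed (auto simp: inv gen)
  qed
  show "range apo_word \<subseteq> apollonian_group"
  proof
    fix M assume "M \<in> range apo_word"
    then obtain "is" where "M = apo_word is" by auto
    moreover have "apo_word is \<in> apollonian_group"
    proof (induction "is")
      case Nil
      then show ?case using generate.one[of GL4Z] by (simp add: apollonian_group_def GL4Z_def)
    next
      case (Cons i "is")
      then show ?case using generate.eng[of _ GL4Z] generate.incl[of _ _ GL4Z]
        by (auto simp: apollonian_group_def GL4Z_def)
    qed
    ultimately show "M \<in> apollonian_group" by simp
  qed
qed

lemma mat_1_in_apollonian_group: "mat 1 \<in> apollonian_group"
  unfolding apollonian_group_eq_range by (rule range_eqI[of _ _ "[]"]) simp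

lemma generator_mult_in_apollonian_group:
  "M \<in> apollonian_group \<Longrightarrow> apollonian_generator i ** M \<in> apollonian_group"
  unfolding apollonian_group_eq_range by (metis apo_word.simps(2) rangeE rangeI)

lemma mult_generator_in_apollonian_group:
  "M \<in> apollonian_group \<Longrightarrow> M ** apollonian_generator i \<in> apollonian_group"
  unfolding apollonian_group_eq_range
  by (metis apo_word.simps apo_word_append matrix_mul_rid rangeE rangeI)

lemma apollonian_group_inverse:
  assumes "M \<in> apollonian_group"
  obtains N where "N \<in> apollonian_group" "N ** M = mat 1"
proof -
  obtain "is" where "M = apo_word is" using assms by (auto simp: apollonian_group_eq_range)
  moreover have "apo_word (rev is) ** apo_word is = mat 1"
  proof (induction "is")
    case (Cons i "is")
    have "apo_word (rev is) ** apollonian_generator i ** (apollonian_generator i ** apo_word is)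
        = apo_word (rev is) ** (apollonian_generator i ** apollonian_generator i) ** apo_word is"
      by (simp only: matrix_mul_assoc)
    with Cons show ?case by (simp add: apo_word_append generator_generator)
  qed simp
  ultimately show ?thesis using that apollonian_group_eq_range by blast
qed

text \<open>A letter put in front either cancels against an equal first letter or keeps the word
  reduced.\<close>

lemma reduced_word_exists:
  assumes "M \<in> apollonian_group"
  obtains "is" where "distinct_adj is" "M = apo_word is"
proof -
  obtain js where "M = apo_word js" using assms by (auto simp: apollonian_group_eq_range)
  moreover have "\<exists>is. distinct_adj is \<and> apo_word is = apo_word js"
  proof (induction js)
    case (Cons j js)
    then obtain "is" where "is": "distinct_adj is" "apo_word is = apo_word js" by blast
    show ?case
    proof (cases "is \<noteq> [] \<and> hd is = j")
      case True
      then have "is = j # tl is" by (cases "is") auto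
      then have "apo_word (j # js) = apollonian_generator j ** apollonian_generator j ** apo_word (tl is)"
        by (metis "is"(2) apo_word.simps(2) matrix_mul_assoc)
      then have "apo_word (tl is) = apo_word (j # js)" by (simp add: generator_generator)
      moreover have "distinct_adj (tl is)" using "is"(1) True by (metis \<open>is = j # tl is\<close> distinct_adj_ConsD)
      ultimately show ?thesis by blast
    next
      case False
      then have "distinct_adj (j # is)" using "is"(1) by (auto simp: distinct_adj_Cons)
      then show ?thesis using "is"(2) by (metis apo_word.simps(2))
    qed
  qed (auto intro: exI[of _ "[]"])
  ultimately show ?thesis using that by metis
qed

text \<open>\<open>peaked j r\<close> holds for the row created by a reduced word with last letter \<open>j\<close>:
  the last letter can be read off as the position of the only negative entry.\<close>
definition peaked :: "4 \<Rightarrow> int^4 \<Rightarrow> bool" where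
  "peaked j r \<longleftrightarrow> r $ j < 0 \<and> (\<forall>k. k \<noteq> j \<longrightarrow> - r $ j \<le> r $ k) \<and>
     (\<forall>k. 2 * r $ k < (\<Sum>l\<in>UNIV. r $ l))"

lemma sum_row_step: "(\<Sum>k\<in>UNIV. row_step j r $ k) = (\<Sum>k\<in>UNIV. r $ k) + 4 * r $ j"
  using exhaust_4[of j] by (auto simp: sum_4 row_step_def)

text \<open>The positive entry at \<open>k\<close> becomes the negative one and all other entries
  gain \<open>2 * r $ k\<close>. The sum gains \<open>4 * r $ k\<close>, which keeps each entry
  below half of it.\<close>

lemma peaked_row_step: "peaked j r \<Longrightarrow> k \<noteq> j \<Longrightarrow> peaked k (row_step k r)"
  unfolding peaked_def sum_row_step unfolding row_step_def
proof (elim conjE, intro conjI allI impI, goal_cases)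
  case (2 l)
  then have "- r $ j \<le> r $ k" "l \<noteq> j \<longrightarrow> - r $ j \<le> r $ l" by auto
  with 2(2,5) show ?case by (cases "l = j") auto
next
  case (3 l)
  then have "- r $ j \<le> r $ k" "2 * r $ k < sum (($) r) UNIV" "2 * r $ l < sum (($) r) UNIV" by auto
  then have "r $ k > 0" using 3(2) by linarith
  moreover have "2 * r $ k < sum (($) r) UNIV" "2 * r $ l < sum (($) r) UNIV" using 3 by auto
  ultimately show ?case by (cases "l = k") simp_all
qed force

lemma peaked_row_step_axis: "peaked i (row_step i (axis i 1))"
  unfolding peaked_def sum_row_step by (auto simp: row_step_def axis_def)

lemma peaked_unique: "peaked j r \<Longrightarrow> peaked k r \<Longrightarrow> j = k"
  unfolding peaked_def by force

lemma not_peaked_axis: "\<not> peaked j (axis i 1)"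
  by (auto simp: peaked_def axis_def split: if_splits)

lemma row_step_axis: "j \<noteq> i \<Longrightarrow> row_step j (axis i 1) = axis i 1"
  by (auto simp: row_step_def axis_def vec_eq_iff)

lemma mat_1_nth: "mat 1 $ i = (axis i 1 :: 'a::zero_neq_one^'n)"
  by (auto simp: mat_def axis_def vec_eq_iff)

text \<open>Letters are added on the right. The first one makes the row of \<open>hd is\<close>
  peaked; each later one differs from the current peak and so moves the peak to itself.\<close>

lemma peaked_hd_apo_word: "is \<noteq> [] \<Longrightarrow> distinct_adj is \<Longrightarrow> peaked (last is) (apo_word is $ hd is)"
proof (induction "is" rule: rev_induct)
  case (snoc j "is")
  have step: "apo_word (is @ [j]) = apo_word is ** apollonian_generator j" by (simp add: apo_word_append)
  show ?case
  proof (cases "is = []")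
    case True
    then show ?thesis unfolding step mult_generator_nth
      by (simp add: mat_1_nth peaked_row_step_axis)
  next
    case False
    with snoc have "peaked (last is) (apo_word is $ hd is)" "j \<noteq> last is"
      by (auto simp: distinct_adj_append_iff)
    then show ?thesis unfolding step mult_generator_nth using False by (simp add: peaked_row_step)
  qed
qed simp

text \<open>Read from the left, letters other than \<open>i\<close> fix the unit vector at
  \<open>i\<close>, the first \<open>i\<close> makes the row peaked, and later letters move the
  peak.\<close>

lemma apo_word_nth_cases:
  assumes "distinct_adj is"
  shows "apo_word is $ i = axis i 1 \<or> (is \<noteq> [] \<and> peaked (last is) (apo_word is $ i))"
  using assms
proof (induction "is" rule: rev_induct)
  case (snoc j "is")
  have step: "apo_word (is @ [j]) = apo_word is ** apollonian_generator j" by (simp add: apo_word_append)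
  from snoc consider "apo_word is $ i = axis i 1" | "is \<noteq> []" "peaked (last is) (apo_word is $ i)" "j \<noteq> last is"
    by (auto simp: distinct_adj_append_iff)
  then show ?case
  proof cases
    case 1
    then show ?thesis unfolding step mult_generator_nth
      by (cases "i = j") (simp_all add: peaked_row_step_axis row_step_axis)
  next
    case 2
    then show ?thesis unfolding step mult_generator_nth by (simp add: peaked_row_step)
  qed
qed (simp add: mat_1_nth)

text \<open>The row reveals the last letter, which can be undone because \<open>row_step\<close> is
  an involution. A unit vector is never peaked, so both words are used up together.\<close>

lemma apo_word_hd_inj:
  assumes "is \<noteq> []" "js \<noteq> []" "distinct_adj is" "distinct_adj js"
    and "apo_word is $ hd is = apo_word js $ hd js"
  shows "is = js"
  using assms
proof (induction "is" arbitrary: js rule: rev_induct)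
  case (snoc i "is")
  obtain j js' where js: "js = js' @ [j]" using snoc.prems(2) by (cases js rule: rev_cases) auto
  have step: "apo_word (is @ [j]) = apo_word is ** apollonian_generator j" for "is" j
    by (simp add: apo_word_append)
  have "i = j" using snoc.prems js peaked_hd_apo_word[of "is @ [i]"] peaked_hd_apo_word[of js]
    by (metis last_snoc peaked_unique)
  \<comment> \<open>\<open>hd\<close> of the empty word is unspecified; removing the only letter
    \<open>j\<close> must leave the unit vector at \<open>j\<close>.\<close>
  define R where "R = (\<lambda>ks. if ks = [] then axis j 1 else apo_word ks $ hd ks)"
  have R: "apo_word (ks @ [j]) $ hd (ks @ [j]) = row_step j (R ks)" for ks
    unfolding step mult_generator_nth by (simp add: R_def mat_1_nth)
  have "R is = R js'" using snoc.prems(5) unfolding js \<open>i = j\<close> R by (metis row_step_row_step)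
  moreover have "distinct_adj is" "distinct_adj js'" using snoc.prems js by auto
  ultimately have "is = js'"
    using snoc.IH[of js'] peaked_hd_apo_word not_peaked_axis by (metis R_def)
  then show ?case by (simp add: js \<open>i = j\<close>)
qed simp

text \<open>The row at the first letter of \<open>is\<close> is peaked at its last letter. Equality
  of the matrices makes it a peaked row for \<open>js\<close> too, so the last letters agree and
  cancel.\<close>

lemma apo_word_inj:
  assumes "distinct_adj is" "distinct_adj js" "apo_word is = apo_word js"
  shows "is = js"
  using assms
proof (induction "is" arbitrary: js rule: rev_induct)
  case Nil
  then show ?case using peaked_hd_apo_word not_peaked_axis
    by (metis apo_word.simps(1) mat_1_nth)
next
  case (snoc i "is")
  have p: "peaked i (apo_word js $ hd (is @ [i]))"
    using peaked_hd_apo_word[OF _ snoc.prems(1)] snoc.prems(3) by simp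
  then have "js \<noteq> []" using not_peaked_axis by (metis apo_word.simps(1) mat_1_nth)
  then obtain j js' where js: "js = js' @ [j]" by (cases js rule: rev_cases) auto
  have "i = j" using apo_word_nth_cases[OF snoc.prems(2)] p not_peaked_axis peaked_unique js
    by (metis last_snoc)
  have "apo_word is ** apollonian_generator j = apo_word js' ** apollonian_generator j"
    using snoc.prems(3) by (simp add: js \<open>i = j\<close> apo_word_append)
  then have "apo_word is = apo_word js'"
    by (metis generator_generator matrix_mul_assoc matrix_mul_rid)
  then show ?case using snoc.IH snoc.prems js \<open>i = j\<close> by blast
qed

section \<open>Tangent rows\<close>

text \<open>The bilinear form with matrix \<open>2 * I - J\<close>, where \<open>J\<close> has all
  entries \<open>1\<close>: the Lorentz product in terms of coefficients relative to a Descartes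
  configuration.\<close>

definition gram :: "int^4 \<Rightarrow> int^4 \<Rightarrow> int" where
  "gram r s = 2 * (\<Sum>k\<in>UNIV. r $ k * s $ k) - (\<Sum>k\<in>UNIV. r $ k) * (\<Sum>k\<in>UNIV. s $ k)"

lemma gram_row_step: "gram (row_step j r) (row_step j s) = gram r s"
  using exhaust_4[of j] unfolding gram_def sum_row_step
  by (elim disjE) (simp_all add: sum_4 row_step_def algebra_simps)

lemma gram_axis: "gram (axis i 1) (axis j 1) = (if i = j then 1 else -1)"
  by (simp add: gram_def axis_def if_distrib[where f = "\<lambda>x. _ * x"] cong: if_cong)

lemma gram_apollonian_group:
  assumes "M \<in> apollonian_group"
  shows "gram (M $ i) (M $ j) = (if i = j then 1 else -1)"
proof -
  obtain "is" where "M = apo_word is" using assms by (auto simp: apollonian_group_eq_range)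
  moreover have "gram (apo_word is $ i) (apo_word is $ j) = (if i = j then 1 else -1)"
    by (induction "is" rule: rev_induct)
      (simp_all add: mat_1_nth gram_axis apo_word_append mult_generator_nth gram_row_step)
  ultimately show ?thesis by simp
qed

text \<open>The product is minus the sum of the entries of \<open>r\<close> with weights
  \<open>?z\<close>, positive since \<open>s\<close> is peaked. The one negative entry, at
  \<open>j\<close>, is outweighed by the entry at \<open>k\<close>, whose weight is larger by at
  least \<open>4\<close>.\<close>

lemma gram_peaked_less:
  assumes r: "peaked j r" and s: "peaked k s" and "j \<noteq> k"
  shows "gram r s < -1"
proof -
  let ?z = "\<lambda>l. (\<Sum>i\<in>UNIV. s $ i) - 2 * s $ l"
  have "gram r s = - (\<Sum>l\<in>UNIV. r $ l * (S - 2 * s $ l))" if "S = (\<Sum>i\<in>UNIV. s $ i)" for S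
    unfolding gram_def that[symmetric]
    by (simp add: sum_distrib_left sum_distrib_right sum_subtractf algebra_simps)
  from this[OF refl] have "gram r s = - (\<Sum>l\<in>UNIV. r $ l * ?z l)" .
  also have "(\<Sum>l\<in>UNIV. r $ l * ?z l) = r $ j * ?z j + r $ k * ?z k + (\<Sum>l\<in>UNIV - {j, k}. r $ l * ?z l)"
    using sum.subset_diff[of "{j, k}" UNIV "\<lambda>l. r $ l * ?z l"] \<open>j \<noteq> k\<close> by simp
  finally have eq: "gram r s = - (r $ j * ?z j + r $ k * ?z k + (\<Sum>l\<in>UNIV - {j, k}. r $ l * ?z l))" .
  have rj: "r $ j < 0" "\<And>l. l \<noteq> j \<Longrightarrow> - r $ j \<le> r $ l" using r by (auto simp: peaked_def)
  have z: "?z l > 0" for l using s by (simp add: peaked_def)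
  have sk: "s $ k < 0" "- s $ k \<le> s $ j" using s \<open>j \<noteq> k\<close> by (auto simp: peaked_def)
  have "(\<Sum>l\<in>UNIV - {j, k}. r $ l * ?z l) \<ge> 0"
    using rj z by (intro sum_nonneg mult_nonneg_nonneg) (force simp: less_imp_le)+
  moreover have "r $ k * ?z k \<ge> - r $ j * ?z k"
    using rj(2)[of k] z[of k] \<open>j \<noteq> k\<close> by (intro mult_right_mono) auto
  moreover have "- r $ j * (2 * (s $ j - s $ k)) \<ge> 1 * 4"
    using rj(1) sk by (intro mult_mono) auto
  ultimately show ?thesis unfolding eq by (simp add: algebra_simps)
qed

lemma ex_other_index: "\<exists>k::4. k \<noteq> i \<and> k \<noteq> j"
proof (rule ccontr)
  assume "\<not> (\<exists>k. k \<noteq> i \<and> k \<noteq> j)"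
  then have "UNIV = {i, j}" by blast
  then have "CARD(4) = card {i, j}" by simp
  also have "\<dots> \<le> 2" by (simp add: card_insert_if)
  finally show False by simp
qed

lemma gram_peaked_axis_less:
  assumes "peaked j r"
  shows "gram r (axis j 1) < -1"
proof -
  obtain k where "k \<noteq> j" using ex_other_index by blast
  then have "r $ j < 0" "- r $ j \<le> r $ k" "2 * r $ k < (\<Sum>l\<in>UNIV. r $ l)"
    using assms by (auto simp: peaked_def)
  moreover have "gram r (axis j 1) = 2 * r $ j - (\<Sum>l\<in>UNIV. r $ l)"
    by (simp add: gram_def axis_def if_distrib[where f = "\<lambda>x. _ * x"] cong: if_cong)
  ultimately show ?thesis by simp
qed

definition apo_rows :: "(int^4) set" where
  "apo_rows = {M $ i |M i. M \<in> apollonian_group}"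

lemma axis_in_apo_rows: "axis i 1 \<in> apo_rows"
  unfolding apo_rows_def mat_1_nth[symmetric] using mat_1_in_apollonian_group by blast

lemma apo_rows_cases:
  assumes "r \<in> apo_rows"
  obtains i where "r = axis i 1" | j where "peaked j r"
  using assms apo_word_nth_cases reduced_word_exists unfolding apo_rows_def by (smt (verit) mem_Collect_eq)

lemma row_step_in_apo_rows: "r \<in> apo_rows \<Longrightarrow> row_step j r \<in> apo_rows"
  unfolding apo_rows_def using mult_generator_in_apollonian_group mult_generator_nth by (smt (verit) mem_Collect_eq)

text \<open>If one of the rows ends in the letter \<open>s\<close>, tangency forces each of the others to end
  in \<open>s\<close> as well or to be a unit vector fixed by the generator \<open>s\<close>, so the letter can be cancelled
  from all of them at once.\<close>
lemma tangent_rows_in_one_matrix: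
  assumes "\<And>j. j \<in> J \<Longrightarrow> f j \<in> apo_rows"
    and "\<And>j k. j \<in> J \<Longrightarrow> k \<in> J \<Longrightarrow> j \<noteq> k \<Longrightarrow> gram (f j) (f k) = -1"
    and "finite J"
  shows "\<exists>M\<in>apollonian_group. \<exists>\<pi>. \<forall>j\<in>J. f j = M $ \<pi> j"
  using assms
proof (induction "\<Sum>j\<in>J. nat (\<Sum>k\<in>UNIV. f j $ k)" arbitrary: f rule: less_induct)
  case less
  show ?case
  proof (cases "\<forall>j\<in>J. \<exists>i. f j = axis i 1")
    case True
    then obtain \<pi> where "\<forall>j\<in>J. f j = axis (\<pi> j) 1" by metis
    then show ?thesis using mat_1_in_apollonian_group by (metis mat_1_nth)
  next
    case False
    then obtain j0 s where j0: "j0 \<in> J" "peaked s (f j0)"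
      using less.prems(1) apo_rows_cases by metis
    \<comment> \<open>A unit vector at \<open>s\<close>, or a row peaked elsewhere, would have
      product below \<open>-1\<close> with \<open>f j0\<close>.\<close>
    have dich: "peaked s (f j) \<or> row_step s (f j) = f j" if "j \<in> J" for j
    proof (cases "j = j0")
      case False
      then have g: "gram (f j0) (f j) = -1" using that j0 less.prems by blast
      from less.prems(1)[OF that] show ?thesis
      proof (cases rule: apo_rows_cases)
        case (1 i)
        then show ?thesis using g gram_peaked_axis_less[OF j0(2)] row_step_axis[of s i] by force
      next
        case (2 t)
        then show ?thesis using g gram_peaked_less[OF j0(2) 2] by force
      qed
    qed (use j0 in simp)
    define g where "g = (\<lambda>j. row_step s (f j))"
    \<comment> \<open>Cancelling \<open>s\<close> adds \<open>4 * f j $ s < 0\<close> to the row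
      sum. The sum of a peaked row is positive, so \<open>nat\<close> keeps the decrease
      strict.\<close>
    have peak_less: "nat (\<Sum>k\<in>UNIV. g j $ k) < nat (\<Sum>k\<in>UNIV. f j $ k)" if "peaked s (f j)" for j
    proof -
      obtain k where "k \<noteq> s" using ex_other_index by blast
      then have "f j $ s < 0" "(\<Sum>k\<in>UNIV. f j $ k) > 0"
        using that unfolding peaked_def by (smt (verit))+
      then show ?thesis unfolding g_def sum_row_step by simp
    qed
    have "(\<Sum>j\<in>J. nat (\<Sum>k\<in>UNIV. g j $ k)) < (\<Sum>j\<in>J. nat (\<Sum>k\<in>UNIV. f j $ k))"
      using less.prems(3) dich peak_less j0 by (intro sum_strict_mono_ex1) (force simp: g_def)+
    from less.hyps[OF this] obtain M \<pi> where M: "M \<in> apollonian_group" "\<forall>j\<in>J. g j = M $ \<pi> j"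
      using less.prems by (auto simp: g_def row_step_in_apo_rows gram_row_step)
    then have "\<forall>j\<in>J. f j = (M ** apollonian_generator s) $ \<pi> j"
      by (metis g_def mult_generator_nth row_step_row_step)
    then show ?thesis using M mult_generator_in_apollonian_group by blast
  qed
qed

section \<open>Gram bases and the packing as an orbit\<close>

definition gramian :: "(4 \<Rightarrow> lvec) \<Rightarrow> bool" where
  "gramian u \<longleftrightarrow> (\<forall>i j. mink (u i) (u j) = (if i = j then 1 else -1))"

definition comb :: "(4 \<Rightarrow> lvec) \<Rightarrow> (4 \<Rightarrow> real) \<Rightarrow> lvec" where
  "comb u c = (\<Sum>k\<in>UNIV. c k *\<^sub>R u k)"

lemma mink_sum_right: "mink x (\<Sum>k\<in>A. f k) = (\<Sum>k\<in>A. mink x (f k))"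
  by (induction A rule: infinite_finite_induct) (auto simp: mink_add_right, auto simp: mink_def)

lemma mink_sum_left: "mink (\<Sum>k\<in>A. f k) x = (\<Sum>k\<in>A. mink (f k) x)"
  using mink_sum_right[of x f A] by (simp add: mink_commute)

lemma mink_gramian_comb:
  assumes "gramian u"
  shows "mink (u k) (comb u c) = 2 * c k - (\<Sum>l\<in>UNIV. c l)"
proof -
  have "mink (u k) (comb u c) = (\<Sum>l\<in>UNIV. c l * (if k = l then 1 else -1))"
    using assms by (simp add: comb_def mink_sum_right mink_scale_right gramian_def)
  also have "\<dots> = (\<Sum>l\<in>UNIV. (if k = l then 2 * c k else 0) - c l)"
    by (intro sum.cong) auto
  also have "\<dots> = 2 * c k - (\<Sum>l\<in>UNIV. c l)" by (simp add: sum_subtractf)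
  finally show ?thesis .
qed

lemma mink_comb_comb:
  assumes "gramian u"
  shows "mink (comb u c) (comb u d) = 2 * (\<Sum>k\<in>UNIV. c k * d k) - (\<Sum>k\<in>UNIV. c k) * (\<Sum>k\<in>UNIV. d k)"
proof -
  have "mink (comb u c) (comb u d) = (\<Sum>k\<in>UNIV. c k * mink (u k) (comb u d))"
    by (simp add: comb_def[of u c] mink_sum_left mink_scale_left)
  also have "\<dots> = 2 * (\<Sum>k\<in>UNIV. c k * d k) - (\<Sum>k\<in>UNIV. c k) * (\<Sum>k\<in>UNIV. d k)"
    unfolding mink_gramian_comb[OF assms]
    by (simp add: right_diff_distrib sum_subtractf sum_distrib_left[of 2] mult.left_commute
        flip: sum_distrib_right)
  finally show ?thesis .
qed

text \<open>The products with the basis are \<open>2 * c k - S\<close> with \<open>S\<close> the sum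
  of the coefficients. The four add up to \<open>-2 * S\<close>, so they determine every
  coefficient.\<close>

lemma comb_inj:
  assumes "gramian u" "comb u c = comb u d"
  shows "c = d"
proof -
  have "2 * c k - (\<Sum>l\<in>UNIV. c l) = 2 * d k - (\<Sum>l\<in>UNIV. d l)" for k
    using assms by (simp flip: mink_gramian_comb)
  note this[of 1] this[of 2] this[of 3] this[of 4]
  then have "c 1 = d 1 \<and> c 2 = d 2 \<and> c 3 = d 3 \<and> c 4 = d 4" by (simp add: sum_4)
  then show ?thesis by (simp add: fun_eq_iff forall_4)
qed

text \<open>Uniqueness of coefficients makes the four vectors independent, and the space has real
  dimension \<open>4\<close>.\<close>

lemma gramian_spans:
  assumes "gramian u"
  obtains c where "x = comb u c"
proof -
  have inj: "inj u"
  proof (rule injI)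
    fix i j assume "u i = u j"
    then have "mink (u i) (u j) = mink (u i) (u i)" by simp
    then show "i = j" using assms by (simp add: gramian_def split: if_splits)
  qed
  have comb: "(\<Sum>y\<in>range u. c y *\<^sub>R y) = comb u (c \<circ> u)" for c
    by (simp add: comb_def sum.reindex[OF inj])
  have "independent (range u)"
  proof
    assume "dependent (range u)"
    then obtain c y where c: "y \<in> range u" "c y \<noteq> 0" "(\<Sum>y\<in>range u. c y *\<^sub>R y) = 0"
      unfolding dependent_finite[OF finite_imageI[OF finite]] by blast
    then have "comb u (c \<circ> u) = comb u (\<lambda>_. 0)" unfolding comb by (simp add: comb_def)
    with c show False using comb_inj[OF assms] by (metis comp_apply rangeE)
  qed
  moreover have "dim (UNIV :: lvec set) \<le> card (range u)"
    by (simp add: card_image[OF inj] dim_UNIV)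
  ultimately have "x \<in> span (range u)"
    using card_ge_dim_independent[of "range u" UNIV] by auto
  then obtain c where "x = (\<Sum>y\<in>range u. c y *\<^sub>R y)" by (auto simp: span_finite)
  then show thesis using that comb by metis
qed

definition act :: "int^4^4 \<Rightarrow> (4 \<Rightarrow> lvec) \<Rightarrow> 4 \<Rightarrow> lvec" where
  "act M u i = comb u (\<lambda>k. of_int (M $ i $ k))"

lemma act_mult: "act (M ** N) u = act M (act N u)"
proof
  fix i
  have "act (M ** N) u i = (\<Sum>l\<in>UNIV. \<Sum>j\<in>UNIV. (of_int (M $ i $ j) * of_int (N $ j $ l)) *\<^sub>R u l)"
    by (simp add: act_def comb_def matrix_matrix_mult_def scaleR_sum_left)
  also have "\<dots> = (\<Sum>j\<in>UNIV. \<Sum>l\<in>UNIV. (of_int (M $ i $ j) * of_int (N $ j $ l)) *\<^sub>R u l)"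
    by (rule sum.swap)
  also have "\<dots> = act M (act N u) i"
    by (simp add: act_def comb_def scaleR_sum_right)
  finally show "act (M ** N) u i = act M (act N u) i" .
qed

lemma comb_axis: "comb u (\<lambda>k. of_int (axis i 1 $ k)) = u i"
  by (simp add: comb_def axis_def if_distrib[where f = of_int] if_distrib[where f = "\<lambda>x. x *\<^sub>R _"] cong: if_cong)

lemma act_mat_1 [simp]: "act (mat 1) u = u"
  by (simp add: act_def mat_1_nth comb_axis fun_eq_iff)

lemma mink_comb_of_int:
  assumes "gramian u"
  shows "mink (comb u (\<lambda>k. of_int (r $ k))) (comb u (\<lambda>k. of_int (s $ k))) = of_int (gram r s)"
  by (simp add: mink_comb_comb[OF assms] gram_def)

lemma gramian_act: "gramian u \<Longrightarrow> M \<in> apollonian_group \<Longrightarrow> gramian (act M u)"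
  unfolding gramian_def[of "act M u"] act_def by (simp add: mink_comb_of_int gram_apollonian_group)

lemma generator_in_apollonian_group: "apollonian_generator i \<in> apollonian_group"
  using generator_mult_in_apollonian_group[OF mat_1_in_apollonian_group] by simp

lemma generator_nth_other: "j \<noteq> i \<Longrightarrow> apollonian_generator i $ j = axis j 1"
  using generator_mult_nth[of i "mat 1" j] by (simp add: mat_1_nth)

lemma act_generator_other: "j \<noteq> i \<Longrightarrow> act (apollonian_generator i) u j = u j"
  by (simp add: act_def generator_nth_other comb_axis)

text \<open>Three mutually tangent circles have just two completions. The three products force equal
  coefficients \<open>t\<close> away from \<open>q\<close>, and the norm condition becomes
  \<open>t * (t - 2) = 0\<close>.\<close>

lemma gramian_completion:
  assumes u: "gramian u" and x: "mink x x = 1" "\<And>k. k \<noteq> q \<Longrightarrow> mink (u k) x = -1"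
  shows "x = u q \<or> x = act (apollonian_generator q) u q"
proof -
  obtain c where c: "x = comb u c" by (rule gramian_spans[OF u])
  define t where "t = ((\<Sum>k\<in>UNIV. c k) - 1) / 2"
  have ck: "c k = t" if "k \<noteq> q" for k
    using x(2)[OF that] unfolding c mink_gramian_comb[OF u] by (simp add: t_def)
  have sum: "(\<Sum>k\<in>UNIV. f (c k)) = 3 * f t + f (c q)" for f :: "real \<Rightarrow> real"
  proof -
    have "(\<Sum>k\<in>UNIV - {q}. f (c k)) = (\<Sum>k\<in>UNIV - {q}. f t)"
      by (intro sum.cong) (auto dest: ck)
    then show ?thesis by (subst sum.remove[of _ q]) (simp_all add: card_Diff_singleton)
  qed
  have "(\<Sum>k\<in>UNIV. c k) = 2 * t + 1" by (simp add: t_def field_simps)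
  with sum[of "\<lambda>x. x"] have cq: "c q = 1 - t" by linarith
  have "2 * (3 * t^2 + (1 - t)^2) - (2 * t + 1)^2 = 1"
    using x(1) sum[of "\<lambda>x. x^2"] sum[of "\<lambda>x. x"] unfolding c mink_comb_comb[OF u]
    by (simp add: cq power2_eq_square)
  then have "t * (t - 2) = 0" by (simp add: power2_eq_square algebra_simps)
  then consider "t = 0" | "t = 2" by auto
  then show ?thesis
  proof cases
    case 1
    then have "c = (\<lambda>k. of_int (axis q 1 $ k))" using ck cq by (auto simp: axis_def fun_eq_iff)
    then show ?thesis using c comb_axis by metis
  next
    case 2
    then have "c = (\<lambda>k. of_int (apollonian_generator q $ q $ k))"
      using ck cq by (auto simp: apollonian_generator_def fun_eq_iff)
    then show ?thesis using c by (simp add: act_def)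
  qed
qed

definition lorentz_orbit :: "(4 \<Rightarrow> lvec) \<Rightarrow> lvec set" where
  "lorentz_orbit u = (\<lambda>r. comb u (\<lambda>k. of_int (r $ k))) ` apo_rows"

text \<open>Three of the vectors come from rows of one matrix \<open>M\<close>. The fourth completes
  them, so it comes from the remaining row or from its replacement by a generator.\<close>

lemma gramian_in_orbit:
  assumes u: "gramian u" and x: "gramian x" and orb: "\<And>j. j \<noteq> p \<Longrightarrow> x j \<in> lorentz_orbit u"
  obtains M \<pi> where "M \<in> apollonian_group" "bij \<pi>" "\<And>j. x j = act M u (\<pi> j)"
proof -
  have "\<forall>j\<in>-{p}. \<exists>r\<in>apo_rows. x j = comb u (\<lambda>k. of_int (r $ k))"
    using orb by (auto simp: lorentz_orbit_def)
  then obtain f where f: "\<And>j. j \<noteq> p \<Longrightarrow> f j \<in> apo_rows"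
    "\<And>j. j \<noteq> p \<Longrightarrow> x j = comb u (\<lambda>k. of_int (f j $ k))"
    by (metis ComplI singletonD)
  have gram: "gram (f j) (f k) = -1" if "j \<noteq> p" "k \<noteq> p" "j \<noteq> k" for j k
  proof -
    have "of_int (gram (f j) (f k)) = mink (x j) (x k)"
      using that by (simp add: f mink_comb_of_int[OF u])
    also have "\<dots> = of_int (-1)" using x that by (simp add: gramian_def)
    finally show ?thesis by (simp only: of_int_eq_iff)
  qed
  obtain M \<pi> where M: "M \<in> apollonian_group" "\<And>j. j \<noteq> p \<Longrightarrow> f j = M $ \<pi> j"
    using tangent_rows_in_one_matrix[of "-{p}" f] f(1) gram by auto
  have inj: "inj_on \<pi> (-{p})"
  proof (rule inj_onI)
    fix j k assume "j \<in> -{p}" "k \<in> -{p}" "\<pi> j = \<pi> k"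
    then show "j = k" using gram[of j k] M gram_apollonian_group[OF M(1)] by force
  qed
  have "card (\<pi> ` (-{p})) \<noteq> card (UNIV :: 4 set)"
    using card_image[OF inj] by (simp add: Compl_eq_Diff_UNIV card_Diff_singleton)
  then obtain q where q: "q \<notin> \<pi> ` (-{p})" by (metis UNIV_eq_I)
  \<comment> \<open>Position \<open>p\<close> is sent to the row that the other three leave
    free.\<close>
  define \<rho> where "\<rho> = \<pi>(p := q)"
  have "inj \<rho>"
    unfolding inj_def \<rho>_def using inj q by (auto simp: inj_on_def)
  then have "bij \<rho>" by (simp add: bij_def finite_UNIV_inj_surj)
  have xj: "x j = act M u (\<rho> j)" if "j \<noteq> p" for j
    using that f M by (simp add: act_def \<rho>_def)
  have gM: "gramian (act M u)" using gramian_act u M(1) by blast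
  have "mink (act M u k) (x p) = -1" if "k \<noteq> q" for k
  proof -
    obtain j where j: "k = \<rho> j" using bij_pointE[OF \<open>bij \<rho>\<close>] by metis
    then have "j \<noteq> p" using that by (auto simp: \<rho>_def)
    then show ?thesis using x xj j by (metis gramian_def)
  qed
  then have "x p = act M u q \<or> x p = act (apollonian_generator q) (act M u) q"
    using x by (intro gramian_completion[OF gM]) (auto simp: gramian_def)
  then consider "x p = act M u (\<rho> p)" | "x p = act (apollonian_generator q ** M) u (\<rho> p)"
    unfolding act_mult by (auto simp: \<rho>_def)
  then show thesis
  proof cases
    case 1
    then show ?thesis using that[OF M(1) \<open>bij \<rho>\<close>] xj by metis
  next
    case 2
    have "\<rho> j \<noteq> q" if "j \<noteq> p" for j using that q by (auto simp: \<rho>_def)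
    then have "x j = act (apollonian_generator q ** M) u (\<rho> j)" for j
      using 2 xj by (cases "j = p") (auto simp: act_mult act_generator_other)
    then show ?thesis using that[OF generator_mult_in_apollonian_group[OF M(1)] \<open>bij \<rho>\<close>] by blast
  qed
qed

section \<open>Time-oriented configurations and the packing\<close>

definition configuration :: "(4 \<Rightarrow> lvec) \<Rightarrow> bool" where
  "configuration u \<longleftrightarrow> gramian u \<and> (\<forall>i j. i \<noteq> j \<longrightarrow> ht (u i) + ht (u j) > 0)"

text \<open>Null vectors with negative product lie on the same half of the light cone: otherwise
  Cauchy-Schwarz and the inequality of arithmetic and geometric means make the product
  nonnegative.\<close>

lemma ht_null_pos:
  assumes "mink x x = 0" "mink y y = 0" "ht y > 0" "mink x y < 0"
  shows "ht x > 0"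
proof (rule ccontr)
  obtain a b m where x: "x = (a, b, m)" by (cases x) auto
  obtain a' b' m' where y: "y = (a', b', m')" by (cases y) auto
  have m: "a * b = (norm m)\<^sup>2" "a' * b' = (norm m')\<^sup>2"
    using mink_null[OF assms(1)] mink_null[OF assms(2)] by (simp_all add: x y)
  have "a' * b' \<ge> 0" "a * b \<ge> 0" using m by simp_all
  moreover assume "\<not> ht x > 0"
  ultimately have sgn: "a \<le> 0" "b \<le> 0" "a' \<ge> 0" "b' \<ge> 0"
    using assms(3) by (auto simp: x y ht_def zero_le_mult_iff)
  define p q where "p = - a * b'" and "q = - b * a'"
  have pq: "p \<ge> 0" "q \<ge> 0" using sgn by (simp_all add: p_def q_def mult_nonpos_nonneg)
  have "(norm m * norm m')\<^sup>2 = p * q" by (simp add: power_mult_distrib p_def q_def flip: m)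
  also have "\<dots> \<le> ((p + q) / 2)\<^sup>2"
    using zero_le_power2[of "p - q"] by (simp add: power2_eq_square field_simps)
  finally have "norm m * norm m' \<le> (p + q) / 2" by (rule power2_le_imp_le) (use pq in simp)
  moreover have "- (m \<bullet> m') \<le> norm m * norm m'"
    using Cauchy_Schwarz_ineq2[of m m'] by linarith
  ultimately show False using assms(4) by (simp add: x y mink_def p_def q_def)
qed

text \<open>Sums of two distinct members are null. The sum \<open>?w j + ?w k\<close> of two
  unchanged members is future-directed, and its product with \<open>?w i + ?w j\<close> is
  \<open>-2\<close>.\<close>

lemma configuration_act_generator:
  assumes "configuration u"
  shows "configuration (act (apollonian_generator i) u)"
proof -
  let ?w = "act (apollonian_generator i) u"
  have u: "gramian u" and pos: "\<And>j k. j \<noteq> k \<Longrightarrow> ht (u j) + ht (u k) > 0"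
    using assms by (auto simp: configuration_def)
  have w: "gramian ?w" using gramian_act[OF u generator_in_apollonian_group] .
  have i: "ht (?w i) + ht (?w j) > 0" if "j \<noteq> i" for j
  proof -
    obtain k where k: "k \<noteq> i" "k \<noteq> j"
      using ex_other_index by blast
    have g: "mink (?w a) (?w b) = (if a = b then 1 else -1)" for a b using w by (simp add: gramian_def)
    have "mink (?w i + ?w j) (?w i + ?w j) = 0" "mink (?w j + ?w k) (?w j + ?w k) = 0"
      using that k by (intro mink_null_add; simp add: g)+
    moreover have "ht (?w j + ?w k) > 0"
      using that k pos by (simp add: ht_add act_generator_other)
    moreover have "mink (?w i + ?w j) (?w j + ?w k) < 0"
      using that k by (simp add: mink_add_left mink_add_right g)
    ultimately have "ht (?w i + ?w j) > 0" by (rule ht_null_pos)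
    then show ?thesis by (simp add: ht_add)
  qed
  have "ht (?w j) + ht (?w k) > 0" if "j \<noteq> k" for j k
    using that i[of j] i[of k] pos[of j k] by (cases "j = i"; cases "k = i") (auto simp: act_generator_other)
  then show ?thesis using w by (simp add: configuration_def)
qed


lemma descartes_configuration_iff:
  "descartes_configuration D \<longleftrightarrow>
    (\<forall>i. oriented_circle (D i)) \<and> configuration (\<lambda>i. coords (D i))"
  unfolding descartes_configuration_def configuration_def gramian_def
  using externally_tangent_iff mink_coords_self by (smt (verit))

text \<open>Each letter keeps three circles already present and replaces the fourth, which is a
  filling step.\<close>

lemma circle_of_act_in_packing:
  assumes u: "configuration u" "\<And>k. circle_of (u k) \<in> packing_from D" and M: "M \<in> apollonian_group"
  shows "circle_of (act M u k) \<in> packing_from D"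
proof -
  obtain "is" where "M = apo_word is" using M by (auto simp: apollonian_group_eq_range)
  moreover have "configuration (act (apo_word is) u) \<and> (\<forall>k. circle_of (act (apo_word is) u k) \<in> packing_from D)"
  proof (induction "is")
    case (Cons i "is")
    define w where "w = act (apo_word is) u"
    define w' where "w' = act (apollonian_generator i) w"
    have w: "\<And>k. circle_of (w k) \<in> packing_from D" and conf: "configuration w'"
      using Cons configuration_act_generator by (auto simp: w_def w'_def)
    have unit: "mink (w' k) (w' k) = 1" for k
      using conf by (simp add: configuration_def gramian_def)
    have "descartes_configuration (\<lambda>k. circle_of (w' k))"
      using conf by (simp add: descartes_configuration_iff oriented_circle_of coords_circle_of unit)
    moreover have other: "circle_of (w' j) \<in> packing_from D" if "j \<noteq> i" for j
      using w[of j] that by (simp add: w'_def act_generator_other)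
    ultimately have "circle_of (w' i) \<in> packing_from D"
      by (rule packing_from.fill)
    with other have "circle_of (w' k) \<in> packing_from D" for k by (cases "k = i") auto
    then show ?case using conf by (simp add: act_mult w_def w'_def)
  qed (use u in simp)
  ultimately show ?thesis by blast
qed

text \<open>A filling step starts from three circles of the orbit, so by
  \<open>gramian_in_orbit\<close> the completed configuration lies there too; conversely, words are
  replayed as filling steps.\<close>

lemma packing_from_eq_orbit:
  assumes "descartes_configuration D"
  shows "packing_from D = circle_of ` lorentz_orbit (\<lambda>i. coords (D i))"
proof
  let ?u = "\<lambda>i. coords (D i)"
  have D: "\<And>i. oriented_circle (D i)" and conf: "configuration ?u"
    using assms by (auto simp: descartes_configuration_iff)
  have u: "gramian ?u" using conf by (simp add: configuration_def)
  have in_orbit: "act M ?u i \<in> lorentz_orbit ?u" if "M \<in> apollonian_group" for M i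
    using that by (auto simp: lorentz_orbit_def act_def apo_rows_def)
  have unit: "mink x x = 1" if "x \<in> lorentz_orbit ?u" for x
    using that gram_apollonian_group
    by (auto simp: lorentz_orbit_def apo_rows_def mink_comb_of_int[OF u])
  show "packing_from D \<subseteq> circle_of ` lorentz_orbit ?u"
  proof
    fix C assume "C \<in> packing_from D"
    then have "oriented_circle C \<and> coords C \<in> lorentz_orbit ?u"
    proof induction
      case (initial i)
      show ?case using D in_orbit[OF mat_1_in_apollonian_group, of i] by simp
    next
      case (fill E i)
      then have "gramian (\<lambda>j. coords (E j))" "\<And>j. oriented_circle (E j)"
        by (auto simp: descartes_configuration_iff configuration_def)
      moreover from this obtain M \<pi> where "M \<in> apollonian_group" "\<And>j. coords (E j) = act M ?u (\<pi> j)"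
        using gramian_in_orbit[OF u, of "\<lambda>j. coords (E j)" i] fill by metis
      ultimately show ?case using in_orbit by simp
    qed
    then show "C \<in> circle_of ` lorentz_orbit ?u" using circle_of_coords by (metis imageI)
  qed
  show "circle_of ` lorentz_orbit ?u \<subseteq> packing_from D"
  proof
    fix C assume "C \<in> circle_of ` lorentz_orbit ?u"
    then obtain M i where "M \<in> apollonian_group" "C = circle_of (act M ?u i)"
      by (auto simp: lorentz_orbit_def act_def apo_rows_def)
    then show "C \<in> packing_from D"
      using circle_of_act_in_packing[OF conf] D by (simp add: circle_of_coords packing_from.initial)
  qed
qed

lemma packing_from_subset:
  assumes "range D \<subseteq> packing_from D'"
  shows "packing_from D \<subseteq> packing_from D'"
proof
  fix C assume "C \<in> packing_from D"
  then show "C \<in> packing_from D'"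
  proof induction
    case (initial i)
    then show ?case using assms by blast
  next
    case (fill E i)
    then show ?case by (metis packing_from.fill)
  qed
qed

text \<open>Allows a change of initial configuration. Up to order \<open>D\<close> is the image of
  \<open>D'\<close> under a group matrix, and the inverse matrix leads back.\<close>

lemma packing_from_eq:
  assumes D: "descartes_configuration D" and D': "descartes_configuration D'"
    and sub: "range D \<subseteq> packing_from D'"
  shows "packing_from D = packing_from D'"
proof
  show "packing_from D \<subseteq> packing_from D'" using sub by (rule packing_from_subset)
  let ?u = "\<lambda>i. coords (D' i)"
  have oD: "\<And>i. oriented_circle (D i)" and oD': "\<And>i. oriented_circle (D' i)"
    and conf: "configuration (\<lambda>i. coords (D i))" and u: "gramian ?u"
    using D D' by (auto simp: descartes_configuration_iff configuration_def)
  have x: "gramian (\<lambda>i. coords (D i))" using conf by (simp add: configuration_def)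
  have "coords (D j) \<in> lorentz_orbit ?u" for j
  proof -
    have "D j \<in> circle_of ` lorentz_orbit ?u" using sub packing_from_eq_orbit[OF D'] by blast
    moreover have "mink y y = 1" if "y \<in> lorentz_orbit ?u" for y
      using that gram_apollonian_group
      by (auto simp: lorentz_orbit_def apo_rows_def mink_comb_of_int[OF u])
    ultimately show ?thesis using coords_circle_of by auto
  qed
  then obtain M \<pi> where M: "M \<in> apollonian_group" "bij \<pi>" "\<And>j. coords (D j) = act M ?u (\<pi> j)"
    using gramian_in_orbit[OF u x] by metis
  obtain N where N: "N \<in> apollonian_group" "N ** M = mat 1"
    using apollonian_group_inverse[OF M(1)] .
  define w where "w = act M ?u"
  have w: "w k = coords (D (inv_into UNIV \<pi> k))" for k
    using M by (simp add: w_def bij_is_surj surj_f_inv_f)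
  have "configuration w"
    unfolding configuration_def using conf M(2) gramian_act[OF u M(1)]
    by (auto simp: w configuration_def w_def[symmetric] bij_imp_bij_inv bij_is_inj inj_eq)
  moreover have "circle_of (w k) \<in> packing_from D" for k
    using oD by (simp add: w circle_of_coords packing_from.initial)
  ultimately have "circle_of (act N w k) \<in> packing_from D" for k
    using circle_of_act_in_packing N by blast
  moreover have "act N w = ?u" unfolding w_def using N by (simp flip: act_mult)
  ultimately have "range D' \<subseteq> packing_from D" using oD' by (auto simp: circle_of_coords)
  then show "packing_from D' \<subseteq> packing_from D" by (rule packing_from_subset)
qed

section \<open>Largest entries\<close>

text \<open>The equation amounts to
  \<open>2 * (x + y) * (z + w) = (x - y)\<^sup>2 + (z - w)\<^sup>2\<close>, so the two pair sums
  cannot have opposite signs.\<close>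

lemma descartes_pair_le:
  fixes x y z w :: "'a::linordered_idom"
  assumes "2 * (x\<^sup>2 + y\<^sup>2 + z\<^sup>2 + w\<^sup>2) = (x + y + z + w)\<^sup>2" "x + y + z + w > 0"
  shows "z + w \<ge> 0"
proof (rule ccontr)
  assume neg: "\<not> z + w \<ge> 0"
  then have "x + y > 0" using assms(2) by linarith
  with neg have "(x + y) * (z + w) < 0" by (simp add: mult_pos_neg)
  moreover have "2 * ((x + y) * (z + w)) = (x - y)\<^sup>2 + (z - w)\<^sup>2"
    using assms(1) by (simp add: power2_eq_square algebra_simps)
  moreover have "(x - y)\<^sup>2 + (z - w)\<^sup>2 \<ge> 0" by simp
  ultimately show False by linarith
qed

text \<open>The two entries at the other positions have nonnegative sum.\<close>

lemma descartes_quadruple_pair_le_sum: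
  fixes u :: "('a::linordered_idom)^4"
  assumes "descartes_quadruple u" "(\<Sum>i\<in>UNIV. u $ i) > 0" "j \<noteq> k"
  shows "u $ j + u $ k \<le> (\<Sum>i\<in>UNIV. u $ i)"
proof -
  have d: "2 * ((u $ 1)\<^sup>2 + (u $ 2)\<^sup>2 + (u $ 3)\<^sup>2 + (u $ 4)\<^sup>2) = (u $ 1 + u $ 2 + u $ 3 + u $ 4)\<^sup>2"
    and s: "u $ 1 + u $ 2 + u $ 3 + u $ 4 > 0"
    using assms by (simp_all add: descartes_quadruple_def sum_4)
  note p = descartes_pair_le[of "u $ 1" "u $ 2" "u $ 3" "u $ 4"] descartes_pair_le[of "u $ 3" "u $ 4" "u $ 1" "u $ 2"]
    descartes_pair_le[of "u $ 1" "u $ 3" "u $ 2" "u $ 4"] descartes_pair_le[of "u $ 2" "u $ 4" "u $ 1" "u $ 3"]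
    descartes_pair_le[of "u $ 1" "u $ 4" "u $ 2" "u $ 3"] descartes_pair_le[of "u $ 2" "u $ 3" "u $ 1" "u $ 4"]
  have "u $ 1 + u $ 2 \<ge> 0" "u $ 1 + u $ 3 \<ge> 0" "u $ 1 + u $ 4 \<ge> 0" "u $ 2 + u $ 3 \<ge> 0"
    "u $ 2 + u $ 4 \<ge> 0" "u $ 3 + u $ 4 \<ge> 0"
    using p d s by (simp_all add: ac_simps)
  then show ?thesis
    using exhaust_4[of j] exhaust_4[of k] \<open>j \<noteq> k\<close> by (elim disjE) (simp_all add: sum_4 algebra_simps)
qed

definition maximal_at :: "int^4 \<Rightarrow> 4 \<Rightarrow> bool" where
  "maximal_at u i \<longleftrightarrow> descartes_quadruple u \<and> (\<Sum>k\<in>UNIV. u $ k) > 0 \<and> (\<forall>k. u $ k \<le> u $ i)"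

text \<open>The new entry is \<open>2 * S - 3 * u $ k\<close>. For \<open>k \<noteq> i\<close> the
  pair bound makes it at least \<open>2 * u $ i - u $ k\<close>, hence at least
  \<open>u $ i\<close>; for \<open>k = i\<close> the second hypothesis does so.\<close>

lemma maximal_at_generator:
  assumes u: "maximal_at u i" and k: "k = i \<Longrightarrow> 2 * u $ i \<le> (\<Sum>l\<in>UNIV. u $ l)"
  shows "maximal_at (apollonian_generator k *v u) k"
proof -
  define S where "S = (\<Sum>l\<in>UNIV. u $ l)"
  define Q where "Q = (\<Sum>l\<in>UNIV - {k}. (u $ l)\<^sup>2)"
  have desc: "descartes_quadruple u" and pos: "S > 0" and max: "\<And>l. u $ l \<le> u $ i"
    using u by (auto simp: maximal_at_def S_def)
  have S: "(\<Sum>l\<in>UNIV - {k}. u $ l) = S - u $ k"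
    by (simp add: S_def sum.remove[of UNIV k])
  have w: "(apollonian_generator k *v u) $ j = (if j = k then 2 * S - 3 * u $ k else u $ j)" for j
    unfolding apollonian_generator_mult_vec S by simp
  have sum_w: "(\<Sum>l\<in>UNIV. f ((apollonian_generator k *v u) $ l))
      = f (2 * S - 3 * u $ k) + (\<Sum>l\<in>UNIV - {k}. f (u $ l))" for f :: "int \<Rightarrow> int"
    by (subst sum.remove[of _ k]) (auto simp: w intro!: sum.cong)
  have new: "2 * S - 3 * u $ k \<ge> u $ i"
  proof (cases "k = i")
    case True
    then show ?thesis using k by (simp add: S_def)
  next
    case False
    then have "u $ k + u $ i \<le> S"
      using descartes_quadruple_pair_le_sum[OF desc] pos by (simp add: S_def)
    then show ?thesis using max[of k] by simp
  qed
  have "2 * ((u $ k)\<^sup>2 + Q) = S\<^sup>2"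
    using desc by (simp add: descartes_quadruple_def Q_def S_def sum.remove[of UNIV k])
  then have "descartes_quadruple (apollonian_generator k *v u)"
    unfolding descartes_quadruple_def sum_w[of "\<lambda>x. x\<^sup>2"] sum_w[of "\<lambda>x. x"] S Q_def[symmetric]
    by (simp add: power2_eq_square algebra_simps)
  moreover have "(\<Sum>l\<in>UNIV. (apollonian_generator k *v u) $ l) > 0"
    unfolding sum_w[of "\<lambda>x. x"] S using new max[of k] pos by simp
  moreover have "(apollonian_generator k *v u) $ l \<le> (apollonian_generator k *v u) $ k" for l
    using new max[of l] by (simp add: w)
  ultimately show ?thesis by (simp add: maximal_at_def)
qed

text \<open>The last letter acts first; if it is \<open>4\<close>, the root condition
  \<open>a + b + c \<ge> d\<close> allows the largest entry to be replaced. Afterwards reducedness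
  means that the current largest entry is never replaced.\<close>

lemma maximal_at_apo_word:
  assumes v: "root_quadruple v"
  shows "is \<noteq> [] \<Longrightarrow> distinct_adj is \<Longrightarrow> maximal_at (apo_word is *v v) (hd is)"
proof (induction "is")
  case (Cons i "is")
  show ?case
  proof (cases "is = []")
    case True
    have "maximal_at v 4"
      using v by (simp add: root_quadruple_def maximal_at_def forall_4)
    then have "maximal_at (apollonian_generator i *v v) i"
      by (rule maximal_at_generator) (use v in \<open>simp add: root_quadruple_def sum_4\<close>)
    then show ?thesis using True by simp
  next
    case False
    then have "maximal_at (apo_word is *v v) (hd is)" "i \<noteq> hd is"
      using Cons by (auto simp: distinct_adj_Cons)
    from maximal_at_generator[OF this(1)] this(2)
    have "maximal_at (apollonian_generator i *v (apo_word is *v v)) i" by blast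
    then show ?thesis by (simp add: matrix_vector_mul_assoc)
  qed
qed simp

section \<open>Counting the circles by reduced words\<close>

definition reduced_word :: "int^4^4 \<Rightarrow> 4 list" where
  "reduced_word M = (THE is. distinct_adj is \<and> apo_word is = M)"

lemma reduced_word_apo_word [simp]: "distinct_adj is \<Longrightarrow> reduced_word (apo_word is) = is"
  unfolding reduced_word_def using apo_word_inj by blast

text \<open>\<open>Inl\<close> stands for the initial circles. For a matrix, the first letter of its
  reduced word names the last replacement performed.\<close>

definition newest_row :: "4 + int^4^4 \<Rightarrow> int^4" where
  "newest_row = case_sum (\<lambda>i. axis i 1) (\<lambda>M. M $ hd (reduced_word M))"

lemma non_identity_reduced_word:
  assumes "M \<in> apollonian_group - {mat 1}"
  obtains "is" where "is \<noteq> []" "distinct_adj is" "M = apo_word is"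
  using assms reduced_word_exists by (metis DiffE apo_word.simps(1) singletonI)

lemma apo_word_nth_newest:
  assumes "distinct_adj is"
  shows "apo_word is $ i = axis i 1 \<or>
    (\<exists>js. js \<noteq> [] \<and> distinct_adj js \<and> apo_word is $ i = apo_word js $ hd js)"
  using assms
proof (induction "is")
  case (Cons j "is")
  show ?case
  proof (cases "i = j")
    case True
    then show ?thesis using Cons.prems by (metis list.sel(1) list.distinct(1))
  next
    case False
    then have "apo_word (j # is) $ i = apo_word is $ i" by (simp add: generator_mult_nth)
    then show ?thesis using Cons distinct_adj_ConsD by metis
  qed
qed (simp add: mat_1_nth)

lemma bij_betw_newest_row:
  "bij_betw newest_row ((UNIV :: 4 set) <+> (apollonian_group - {mat 1})) apo_rows"
proof (rule bij_betw_imageI)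
  show "inj_on newest_row ((UNIV :: 4 set) <+> (apollonian_group - {mat 1}))"
  proof (rule inj_onI)
    fix x y :: "4 + int^4^4"
    assume xy: "x \<in> UNIV <+> (apollonian_group - {mat 1})" "y \<in> UNIV <+> (apollonian_group - {mat 1})"
      and eq: "newest_row x = newest_row y"
    have ax: "axis i 1 \<noteq> M $ hd (reduced_word M)" if "M \<in> apollonian_group - {mat 1}" for i M
      using that by (elim non_identity_reduced_word) (metis not_peaked_axis peaked_hd_apo_word reduced_word_apo_word)
    have mm: "M = N" if "M \<in> apollonian_group - {mat 1}" "N \<in> apollonian_group - {mat 1}"
      "M $ hd (reduced_word M) = N $ hd (reduced_word N)" for M N
      using that by (elim non_identity_reduced_word) (metis apo_word_hd_inj reduced_word_apo_word)
    show "x = y"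
      using xy eq ax mm by (cases x; cases y) (auto simp: newest_row_def axis_eq_axis, metis+)
  qed
  show "newest_row ` (UNIV <+> (apollonian_group - {mat 1})) = apo_rows"
  proof
    show "newest_row ` (UNIV <+> (apollonian_group - {mat 1})) \<subseteq> apo_rows"
      using axis_in_apo_rows by (auto simp: newest_row_def) (auto simp: apo_rows_def)
    show "apo_rows \<subseteq> newest_row ` (UNIV <+> (apollonian_group - {mat 1}))"
    proof
      fix r assume "r \<in> apo_rows"
      then obtain M i where M: "M \<in> apollonian_group" "r = M $ i" by (auto simp: apo_rows_def)
      then obtain "is" where "distinct_adj is" "M = apo_word is" using reduced_word_exists by metis
      then consider "r = axis i 1" | js where "js \<noteq> []" "distinct_adj js" "r = apo_word js $ hd js"
        using apo_word_nth_newest M by blast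
      then show "r \<in> newest_row ` (UNIV <+> (apollonian_group - {mat 1}))"
      proof cases
        case 1
        then show ?thesis by (intro image_eqI[of _ _ "Inl i"]) (auto simp: newest_row_def)
      next
        case 2
        have "apo_word js \<noteq> mat 1"
          using apo_word_inj[of js "[]"] 2 by auto
        then show ?thesis using 2
          by (intro image_eqI[of _ _ "Inr (apo_word js)"]) (auto simp: newest_row_def apollonian_group_eq_range)
      qed
    qed
  qed
qed

theorem theorem3p3:
  fixes v :: "int^4" and P :: "ocircle set"
  assumes "root_quadruple v"
    and "packing_with_curvatures P v"
  shows "\<exists>\<phi>. bij_betw \<phi> ((UNIV :: 4 set) <+> (apollonian_group - {mat 1})) P \<and>
           (\<forall>i. curvature (\<phi> (Inl i)) = of_int (v $ i)) \<and>
           (\<forall>M \<in> apollonian_group - {mat 1}.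
              curvature (\<phi> (Inr M)) = of_int (Max (range (\<lambda>i. (M *v v) $ i))))"
proof -
  obtain D\<^sub>0 D where D0: "descartes_configuration D\<^sub>0" "P = packing_from D\<^sub>0"
    and D: "descartes_configuration D" "range D \<subseteq> P" "\<And>i. curvature (D i) = of_int (v $ i)"
    using assms(2) by (auto simp: packing_with_curvatures_def apollonian_packing_def)
  let ?u = "\<lambda>i. coords (D i)"
  let ?row = "\<lambda>r. comb ?u (\<lambda>k. of_int (r $ k))"
  have u: "gramian ?u" using D by (simp add: descartes_configuration_iff configuration_def)
  \<comment> \<open>The curvatures \<open>v\<close> are those of \<open>D\<close>, so the orbit is
    based at \<open>D\<close> instead of \<open>D\<^sub>0\<close>.\<close>
  have P: "P = circle_of ` lorentz_orbit ?u"
    using packing_from_eq D D0 packing_from_eq_orbit by metis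
  have unit: "mink (?row r) (?row r) = 1" if "r \<in> apo_rows" for r
    using that gram_apollonian_group by (auto simp: apo_rows_def mink_comb_of_int[OF u])
  have "inj_on (circle_of \<circ> ?row) apo_rows"
  proof (rule inj_onI)
    fix r s assume "r \<in> apo_rows" "s \<in> apo_rows" "(circle_of \<circ> ?row) r = (circle_of \<circ> ?row) s"
    then have "?row r = ?row s" by (metis comp_apply coords_circle_of unit)
    from comb_inj[OF u this] show "r = s" by (simp add: fun_eq_iff vec_eq_iff)
  qed
  then have "bij_betw (circle_of \<circ> ?row) apo_rows P"
    by (simp add: bij_betw_def P lorentz_orbit_def image_comp)
  with bij_betw_newest_row
  have bij: "bij_betw (circle_of \<circ> ?row \<circ> newest_row) (UNIV <+> (apollonian_group - {mat 1})) P"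
    by (rule bij_betw_trans)
  \<comment> \<open>Curvature is the first Lorentz entry, hence linear in the coefficients; a row of
    \<open>M\<close> yields the matching entry of \<open>M *v v\<close>.\<close>
  have curv: "curvature (circle_of (?row r)) = of_int (\<Sum>k\<in>UNIV. r $ k * v $ k)" if "r \<in> apo_rows" for r
  proof -
    have "curvature (circle_of (?row r)) = fst (?row r)"
      using unit[OF that] by (simp add: coords_circle_of flip: fst_coords)
    then show ?thesis by (simp add: comb_def fst_sum fst_coords D)
  qed
  show ?thesis
  proof (intro exI conjI allI ballI)
    show "bij_betw (circle_of \<circ> ?row \<circ> newest_row) (UNIV <+> (apollonian_group - {mat 1})) P"
      by (rule bij)
  next
    fix i
    show "curvature ((circle_of \<circ> ?row \<circ> newest_row) (Inl i)) = of_int (v $ i)"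
      using D(1,3) by (simp add: newest_row_def comb_axis circle_of_coords descartes_configuration_iff)
  next
    fix M assume "M \<in> apollonian_group - {mat 1}"
    then obtain "is" where "is": "is \<noteq> []" "distinct_adj is" "M = apo_word is"
      by (rule non_identity_reduced_word)
    have "maximal_at (M *v v) (hd is)" using maximal_at_apo_word[OF assms(1)] "is" by simp
    \<comment> \<open>The maximum sits at the very index that \<open>newest_row\<close>
      selects.\<close>
    then have "Max (range (\<lambda>i. (M *v v) $ i)) = (M *v v) $ hd is"
      by (intro Max_eqI) (auto simp: maximal_at_def)
    moreover have "M $ hd is \<in> apo_rows" using "is" by (auto simp: apo_rows_def apollonian_group_eq_range)
    ultimately show "curvature ((circle_of \<circ> ?row \<circ> newest_row) (Inr M))
        = of_int (Max (range (\<lambda>i. (M *v v) $ i)))"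
      using "is" by (simp add: newest_row_def curv matrix_vector_mult_def)
  qed
qed

end
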